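(* Let $p$ be a prime number and let $\mathbf G$ be a group such that the power graphs $\mathcal G(\mathbb Q\times\mathbf C_{p^\infty})$ and $\mathcal G(\mathbf G)$ are isomorphic as graphs. Then $\mathbf G\cong\mathbb Q\times\mathbf C_{p^\infty}$ as groups.
   Context: Here $\mathbb Q$ denotes the additive group of rational numbers and $\mathbf C_{p^\infty}$ denotes the Prüfer (quasicyclic) $p$-group. The power graph $\mathcal G(\mathbf G)$ of a group $\mathbf G$ is the simple undirected graph whose vertex set is the underlying set $G$ and in which distinct $x,y\in G$ are adjacent if and only if $y=x^n$ or $x=y^n$ (in multiplicative notation) for some nonzero integer $n$. *)

theory Defs
  imports Complex_Main "HOL-Computational_Algebra.Primes" "HOL-Algebra.Group"
begin

text \<open>Simple undirected graphs, possibly infinite: a vertex set together with a set of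
  two-element sets of vertices.\<close>

record 'a sgraph =
  vertices :: "'a set"
  edges :: "'a set set"

definition simple_graph :: "'a sgraph \<Rightarrow> bool" where
  "simple_graph \<Gamma> \<longleftrightarrow>
     (\<forall>e\<in>edges \<Gamma>. \<exists>x\<in>vertices \<Gamma>. \<exists>y\<in>vertices \<Gamma>. x \<noteq> y \<and> e = {x, y})"

definition graph_isomorphic :: "'a sgraph \<Rightarrow> 'b sgraph \<Rightarrow> bool" where
  "graph_isomorphic \<Gamma> \<Delta> \<longleftrightarrow>
     (\<exists>f. bij_betw f (vertices \<Gamma>) (vertices \<Delta>) \<and>
          (\<forall>x\<in>vertices \<Gamma>. \<forall>y\<in>vertices \<Gamma>.
             {x, y} \<in> edges \<Gamma> \<longleftrightarrow> {f x, f y} \<in> edges \<Delta>))"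

definition power_graph :: "('a, 'm) monoid_scheme \<Rightarrow> 'a sgraph" where
  "power_graph G =
     \<lparr>vertices = carrier G,
      edges = {{x, y} | x y. x \<in> carrier G \<and> y \<in> carrier G \<and> x \<noteq> y \<and>
        (\<exists>n::int. n \<noteq> 0 \<and> (y = x [^]\<^bsub>G\<^esub> n \<or> x = y [^]\<^bsub>G\<^esub> n))}\<rparr>"

lemma simple_graph_power_graph: "simple_graph (power_graph G)"
  by (auto simp: simple_graph_def power_graph_def)

lemma power_graph_adjacent_iff:
  "{x, y} \<in> edges (power_graph G) \<longleftrightarrow>
     x \<in> carrier G \<and> y \<in> carrier G \<and> x \<noteq> y \<and>
     (\<exists>n::int. n \<noteq> 0 \<and> (y = x [^]\<^bsub>G\<^esub> n \<or> x = y [^]\<^bsub>G\<^esub> n))"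
  by (auto simp: power_graph_def doubleton_eq_iff)

definition rational_group :: "rat monoid" where
  "rational_group = \<lparr>carrier = UNIV, mult = (+), one = 0\<rparr>"

lemma group_rational_group: "group rational_group"
proof (rule groupI)
  fix x :: rat
  show "\<exists>y\<in>carrier rational_group. y \<otimes>\<^bsub>rational_group\<^esub> x = \<one>\<^bsub>rational_group\<^esub>"
    by (auto simp: rational_group_def intro: exI [of _ "- x"])
qed (auto simp: rational_group_def)

text \<open>The Pruefer group is realised as the multiplicative group of all complex roots of unity
  whose order is a power of \<open>p\<close>.\<close>

definition pruefer_group :: "nat \<Rightarrow> complex monoid" where
  "pruefer_group p = \<lparr>carrier = {z. \<exists>k. z ^ (p ^ k) = 1}, mult = (*), one = 1\<rparr>"

lemma group_pruefer_group:
  assumes "prime p"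
  shows "group (pruefer_group p)"
proof (rule groupI)
  fix x y
  assume "x \<in> carrier (pruefer_group p)" "y \<in> carrier (pruefer_group p)"
  then obtain k l where k: "x ^ (p ^ k) = 1" and l: "y ^ (p ^ l) = 1"
    by (auto simp: pruefer_group_def)
  have "x ^ (p ^ (k + l)) = (x ^ (p ^ k)) ^ (p ^ l)"
    by (simp add: power_add flip: power_mult)
  moreover have "y ^ (p ^ (k + l)) = (y ^ (p ^ l)) ^ (p ^ k)"
    by (simp add: power_add mult.commute flip: power_mult)
  ultimately have "(x * y) ^ (p ^ (k + l)) = 1"
    using k l by (simp add: power_mult_distrib)
  then show "x \<otimes>\<^bsub>pruefer_group p\<^esub> y \<in> carrier (pruefer_group p)"
    by (auto simp: pruefer_group_def)
next
  fix x
  assume "x \<in> carrier (pruefer_group p)"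
  then obtain k where k: "x ^ (p ^ k) = 1"
    by (auto simp: pruefer_group_def)
  have "x \<noteq> 0"
    using k prime_gt_0_nat [OF assms] by (auto simp: power_0_left)
  moreover have "inverse x ^ (p ^ k) = 1"
    using k by (simp add: power_inverse)
  ultimately show "\<exists>y\<in>carrier (pruefer_group p).
      y \<otimes>\<^bsub>pruefer_group p\<^esub> x = \<one>\<^bsub>pruefer_group p\<^esub>"
    by (auto simp: pruefer_group_def intro!: exI [of _ "inverse x"])
qed (auto simp: pruefer_group_def)

end

theory Submission
  imports Defs "HOL-Algebra.Multiplicative_Group"
begin

text \<open>
  Let \<open>H\<close> be the product of the rationals and the Pruefer \<open>p\<close>-group. Two elements are
  adjacent in a power graph iff one is a nonzero power of the other; which one is the power is not
  recorded. Once the directions of the edges between elements of infinite order are recovered,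
  the group can be reconstructed.

  Torsion. The identity of a group is adjacent to every other torsion element, and elements of
  infinite order are comparable only with each other. In \<open>H\<close> no element of infinite order is
  adjacent to all other elements of its connected component, so the identity of \<open>G\<close> corresponds to a
  torsion element of \<open>H\<close> and torsion corresponds to torsion
  (\<open>comparability_iso_torsion_iff\<close>). The torsion elements of \<open>H\<close> are pairwise comparable
  and infinite in number; a group with this property has a divisible torsion part that is primary
  for a single prime \<open>q\<close> (\<open>torsion_chain_primary\<close>, \<open>torsion_chain_divisible\<close>).

  Direction. For \<open>x\<close> of infinite order, every strict root of \<open>x\<close> is comparable with every strict
  power of \<open>x\<close>, whereas any two strict powers of \<open>x\<close> have a common incomparable strict power
  \<open>x\<^sup>r\<close>, with \<open>r\<close> a large prime, and the same holds for strict roots if the group is divisible.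
  So in the graph of non-adjacency on the neighbours of \<open>x\<close> that are not mutual powers of \<open>x\<close>,
  strict roots and strict powers of \<open>x\<close> are two separate components, and a graph isomorphism
  can only keep or swap them. It
  cannot swap them, because two powers of an element always have a common power, while in \<open>H\<close> some
  pairs of \<open>p\<close>-th roots have no common root
  (\<open>comparability_iso_preserves_direction\<close>).

  Structure. With the directions known, steps of prime exponent are visible, although the primes
  themselves are not. Distinct \<open>l\<close>-th roots of an element of infinite order never have a common root,
  whereas in an abelian group roots with coprime exponents do. Hence the \<open>l\<close>-th roots of an
  element of \<open>G\<close> inject into the elements of \<open>H\<close> killed by one prime
  (\<open>prime_roots_inject_into_torsion\<close>), and every element of infinite order in \<open>G\<close> has only
  finitely many \<open>n\<close>-th roots. The image in \<open>G\<close> of a copy of the rationals in \<open>H\<close> is again divisible and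
  locally cyclic (\<open>power_digraph_iso_rational_spine\<close>). Conjugation by it permutes finite sets
  of roots, and a divisible group acts trivially on a finite set, so it is central
  (\<open>spine_element_commutes\<close>). As all elements of infinite order are commensurable, \<open>G\<close> is generated by
  this central part and its torsion, hence abelian and divisible
  (\<open>comm_divisible_if_spine_and_finite_roots\<close>). Comparing numbers of roots in both
  directions gives \<open>q = p\<close> (\<open>rational_times_pruefer_prime_le\<close>).

  Conclusion. The properties collected in \<open>rational_times_pruefer\<close> determine a group up to
  isomorphism, because such a group is exhausted by subgroups that are products of an infinite
  cyclic group and a cyclic group of order a power of \<open>p\<close>, embedded in each other by
  prescribed exponents (\<open>resolutions_imp_iso\<close>).
\<close>

section \<open>Powers, roots and elements of infinite order\<close>

definition torsion :: "('a, 'm) monoid_scheme \<Rightarrow> 'a set" where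
  "torsion K = {x \<in> carrier K. \<exists>n::int. n \<noteq> 0 \<and> x [^]\<^bsub>K\<^esub> n = \<one>\<^bsub>K\<^esub>}"

definition nontorsion :: "('a, 'm) monoid_scheme \<Rightarrow> 'a set" where
  "nontorsion K = carrier K - torsion K"

definition has_power :: "('a, 'm) monoid_scheme \<Rightarrow> 'a \<Rightarrow> 'a \<Rightarrow> bool" where
  "has_power K x y \<longleftrightarrow> (\<exists>n::int. n \<noteq> 0 \<and> y = x [^]\<^bsub>K\<^esub> n)"

definition strict_power :: "('a, 'm) monoid_scheme \<Rightarrow> 'a \<Rightarrow> 'a \<Rightarrow> bool" where
  "strict_power K x y \<longleftrightarrow> has_power K x y \<and> \<not> has_power K y x"

definition comparable :: "('a, 'm) monoid_scheme \<Rightarrow> 'a \<Rightarrow> 'a \<Rightarrow> bool" where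
  "comparable K x y \<longleftrightarrow> has_power K x y \<or> has_power K y x"

definition common_root :: "('a, 'm) monoid_scheme \<Rightarrow> 'a \<Rightarrow> 'a \<Rightarrow> bool" where
  "common_root K x y \<longleftrightarrow> (\<exists>z\<in>carrier K. has_power K z x \<and> has_power K z y)"

text \<open>
  Divisibility is stated for subsets, so that it applies to a group, to its torsion part and to
  copies of the rationals without their zero.
\<close>
definition divisible_set :: "('a, 'm) monoid_scheme \<Rightarrow> 'a set \<Rightarrow> bool" where
  "divisible_set K A \<longleftrightarrow> (\<forall>x\<in>A. \<forall>n::int. n > 0 \<longrightarrow> (\<exists>y\<in>A. y [^]\<^bsub>K\<^esub> n = x))"

lemma comparable_commute: "comparable K x y \<longleftrightarrow> comparable K y x"
  by (auto simp: comparable_def)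

context group
begin

lemma nontorsion_carrier: "x \<in> nontorsion G \<Longrightarrow> x \<in> carrier G"
  by (simp add: nontorsion_def)

lemma torsion_carrier: "x \<in> torsion G \<Longrightarrow> x \<in> carrier G"
  by (simp add: torsion_def)

lemma torsion_nat_pow:
  assumes "x \<in> torsion G"
  obtains n :: nat where "n > 0" "x [^] n = \<one>"
proof -
  obtain n :: int where n: "n \<noteq> 0" "x [^] n = \<one>" and x: "x \<in> carrier G"
    using assms by (auto simp: torsion_def)
  have "x [^] \<bar>n\<bar> = \<one>"
    using n x by (cases "n \<ge> 0") (auto simp: int_pow_neg)
  then have "x [^] nat \<bar>n\<bar> = \<one>"
    by (simp add: pow_nat)
  then show thesis using n that[of "nat \<bar>n\<bar>"] by simp
qed

lemma has_power_refl: "x \<in> carrier G \<Longrightarrow> has_power G x x"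
  unfolding has_power_def by (intro exI[of _ 1]) simp

lemma has_power_trans:
  "x \<in> carrier G \<Longrightarrow> has_power G x y \<Longrightarrow> has_power G y z \<Longrightarrow> has_power G x z"
  unfolding has_power_def by (metis int_pow_pow mult_eq_0_iff)

lemma has_power_pow: "n \<noteq> 0 \<Longrightarrow> has_power G x (x [^] (n::int))"
  by (auto simp: has_power_def)

lemma has_power_carrier: "x \<in> carrier G \<Longrightarrow> has_power G x y \<Longrightarrow> y \<in> carrier G"
  by (auto simp: has_power_def)

lemma nontorsion_pow_eq_iff:
  assumes "x \<in> nontorsion G"
  shows "x [^] (i::int) = x [^] j \<longleftrightarrow> i = j"
proof
  assume eq: "x [^] i = x [^] j"
  have "x [^] (i - j) = \<one>"
    using assms eq by (simp add: int_pow_diff nontorsion_carrier)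
  then have "i - j = 0"
    using assms by (auto simp only: nontorsion_def torsion_def)
  then show "i = j" by simp
qed simp

lemma torsion_pow: "x \<in> torsion G \<Longrightarrow> x [^] (n::int) \<in> torsion G"
  unfolding torsion_def
  by (auto simp: int_pow_pow) (metis int_pow_one int_pow_pow mult.commute)

lemma torsion_if_pow:
  "x \<in> carrier G \<Longrightarrow> n \<noteq> 0 \<Longrightarrow> x [^] (n::int) \<in> torsion G \<Longrightarrow> x \<in> torsion G"
  unfolding torsion_def by (auto simp: int_pow_pow) (metis mult_eq_0_iff)

lemma has_power_nontorsion_iff:
  assumes "x \<in> carrier G" "has_power G x y"
  shows "x \<in> nontorsion G \<longleftrightarrow> y \<in> nontorsion G"
  using assms torsion_pow torsion_if_pow unfolding has_power_def nontorsion_def by blast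

lemma nontorsion_pow: "x \<in> nontorsion G \<Longrightarrow> n \<noteq> 0 \<Longrightarrow> x [^] (n::int) \<in> nontorsion G"
  using has_power_nontorsion_iff has_power_pow nontorsion_carrier by blast

lemma has_power_pow_pow_iff:
  assumes "x \<in> nontorsion G" "i \<noteq> 0" "j \<noteq> 0"
  shows "has_power G (x [^] (i::int)) (x [^] j) \<longleftrightarrow> i dvd j"
  using assms
  by (auto simp: has_power_def int_pow_pow nontorsion_carrier nontorsion_pow_eq_iff elim!: dvdE)

lemma strict_power_pow:
  assumes "x \<in> nontorsion G" "strict_power G x y"
  obtains k :: int where "y = x [^] k" "\<bar>k\<bar> \<ge> 2"
proof -
  obtain k :: int where k: "k \<noteq> 0" "y = x [^] k"
    using assms by (auto simp: strict_power_def has_power_def)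
  have "\<not> k dvd 1"
    using assms k has_power_pow_pow_iff[of x k 1]
    by (simp add: nontorsion_carrier strict_power_def)
  with k have "\<bar>k\<bar> \<ge> 2" by auto
  with k show thesis using that by blast
qed

lemma strict_power_powI:
  assumes "x \<in> nontorsion G" "\<bar>k\<bar> \<ge> 2"
  shows "strict_power G x (x [^] (k::int))"
  using assms has_power_pow_pow_iff[of x k 1] has_power_pow_pow_iff[of x 1 k]
  by (auto simp: nontorsion_carrier strict_power_def)

text \<open>
  If \<open>y = x\<^sup>n\<close> with \<open>\<bar>n\<bar> \<ge> 2\<close>, then \<open>x\<close>
  to the power \<open>\<bar>n\<bar> + 1\<close> tells the two elements apart: this exponent is
  coprime to \<open>n\<close> and larger.
\<close>
lemma same_comparables_imp_mutual_powers:
  assumes x: "x \<in> nontorsion G" and y: "y \<in> nontorsion G" and xy: "has_power G x y"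
    and same: "\<And>z. z \<in> nontorsion G \<Longrightarrow> comparable G z x \<Longrightarrow> comparable G z y"
  shows "has_power G y x"
proof (rule ccontr)
  assume "\<not> has_power G y x"
  then obtain n :: int where n: "y = x [^] n" "\<bar>n\<bar> \<ge> 2"
    using strict_power_pow x xy by (metis strict_power_def)
  define k where "k = \<bar>n\<bar> + 1"
  have "comparable G (x [^] k) y"
    using n x by (intro same nontorsion_pow) (auto simp: k_def comparable_def intro: has_power_pow)
  then have "k dvd n \<or> n dvd k"
    using n x has_power_pow_pow_iff[of x k n] has_power_pow_pow_iff[of x n k]
    by (auto simp: comparable_def k_def)
  moreover have "0 < \<bar>n\<bar>" "\<bar>n\<bar> < k" using n by (auto simp: k_def)
  then have "\<not> k dvd n"
    using zdvd_not_zless dvd_abs_iff by blast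
  moreover have "\<not> n dvd k"
  proof
    assume "n dvd k"
    then have "n dvd 1" unfolding k_def using dvd_add_right_iff[of n "\<bar>n\<bar>" 1] by simp
    with n show False by auto
  qed
  ultimately show False by blast
qed

end

lemma large_prime_avoids:
  fixes k l :: int
  assumes "\<bar>k\<bar> \<ge> 2" "\<bar>l\<bar> \<ge> 2"
  obtains r :: int where "r \<ge> 2" "\<not> r dvd k" "\<not> k dvd r" "\<not> r dvd l" "\<not> l dvd r"
proof -
  obtain q :: nat where q: "prime q" "q > nat (\<bar>k\<bar> + \<bar>l\<bar>)"
    using bigger_prime by blast
  have "\<not> int q dvd m \<and> \<not> m dvd int q" if "\<bar>m\<bar> \<ge> 2" "\<bar>m\<bar> < int q" for m
  proof
    have "0 < \<bar>m\<bar>" using that by linarith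
    then show "\<not> int q dvd m" using zdvd_not_zless that(2) dvd_abs_iff by blast
    show "\<not> m dvd int q"
    proof
      assume "m dvd int q"
      then have "nat \<bar>m\<bar> dvd q" by (simp add: nat_abs_dvd_iff)
      then have "nat \<bar>m\<bar> = 1 \<or> nat \<bar>m\<bar> = q" using q(1) prime_nat_iff by blast
      with that show False by linarith
    qed
  qed
  with assms q prime_ge_2_nat[OF q(1)] show thesis by (intro that[of "int q"]) auto
qed

context group
begin

text \<open>
  This makes the strict powers of \<open>x\<close> connected by incomparability.
\<close>
lemma strict_powers_share_incomparable:
  assumes x: "x \<in> nontorsion G" and "strict_power G x y" "strict_power G x z"
  obtains w where "strict_power G x w" "\<not> comparable G w y" "\<not> comparable G w z"
proof -
  obtain k :: int where k: "y = x [^] k" "\<bar>k\<bar> \<ge> 2" using strict_power_pow assms by blast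
  obtain l :: int where l: "z = x [^] l" "\<bar>l\<bar> \<ge> 2" using strict_power_pow assms by blast
  obtain r :: int where r: "r \<ge> 2" "\<not> r dvd k" "\<not> k dvd r" "\<not> r dvd l" "\<not> l dvd r"
    using large_prime_avoids k l by blast
  have "r \<noteq> 0" "k \<noteq> 0" "l \<noteq> 0" using r k l by auto
  then have "\<not> comparable G (x [^] r) y" "\<not> comparable G (x [^] r) z"
    using r x by (auto simp: comparable_def k l has_power_pow_pow_iff)
  then show thesis using that[of "x [^] r"] strict_power_powI x r by simp
qed

lemma has_power_roots_imp_dvd:
  assumes x: "x \<in> nontorsion G" and y: "y [^] (k::int) = x"
    and w: "w \<in> carrier G" "w [^] (r::int) = x" and wy: "has_power G w y"
  shows "k dvd r"
proof -
  obtain n :: int where n: "y = w [^] n" using wy by (auto simp: has_power_def)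
  have "w \<in> nontorsion G"
    using x w unfolding nontorsion_def by (auto dest: torsion_pow)
  moreover have "w [^] r = w [^] (n * k)" using y w n by (simp add: int_pow_pow)
  ultimately show ?thesis by (simp add: nontorsion_pow_eq_iff)
qed

text \<open>
  The counterpart for roots needs a root of large prime exponent, which divisibility supplies.
\<close>
lemma strict_roots_share_incomparable:
  assumes div: "divisible_set G (carrier G)" and x: "x \<in> nontorsion G"
    and y: "y \<in> carrier G" "strict_power G y x" and z: "z \<in> carrier G" "strict_power G z x"
  obtains w where "w \<in> carrier G" "strict_power G w x" "\<not> comparable G w y" "\<not> comparable G w z"
proof -
  have nt: "y \<in> nontorsion G" "z \<in> nontorsion G"
    using x y z has_power_nontorsion_iff unfolding strict_power_def by blast+
  obtain k :: int where k: "x = y [^] k" "\<bar>k\<bar> \<ge> 2"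
    using nt(1) y(2) by (rule strict_power_pow)
  obtain l :: int where l: "x = z [^] l" "\<bar>l\<bar> \<ge> 2"
    using nt(2) z(2) by (rule strict_power_pow)
  obtain r :: int where r: "r \<ge> 2" "\<not> r dvd k" "\<not> k dvd r" "\<not> r dvd l" "\<not> l dvd r"
    using k(2) l(2) by (rule large_prime_avoids)
  have "r > 0" using r(1) by simp
  then obtain w where w: "w \<in> carrier G" "w [^] r = x"
    using div x unfolding divisible_set_def by (meson nontorsion_carrier)
  have "has_power G w x" using r(1) w(2) unfolding has_power_def by (metis not_numeral_le_zero)
  then have "w \<in> nontorsion G" using w x has_power_nontorsion_iff by blast
  then have "strict_power G w x" using strict_power_powI[of w r] r(1) w(2) by simp
  moreover have "\<not> comparable G w y"
    using has_power_roots_imp_dvd x k(1) w y(1) r(2,3) unfolding comparable_def by metis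
  moreover have "\<not> comparable G w z"
    using has_power_roots_imp_dvd x l(1) w z(1) r(4,5) unfolding comparable_def by metis
  ultimately show thesis using that w by blast
qed

text \<open>
  A strict root and a strict power of the same element are comparable by transitivity.
\<close>
lemma incomparable_strict_neighbours_same_side:
  assumes "y \<in> carrier G" "z \<in> carrier G" "strict_power G x y \<or> strict_power G y x"
    "strict_power G x z \<or> strict_power G z x" "\<not> comparable G y z"
  shows "strict_power G x y \<longleftrightarrow> strict_power G x z"
  using assms has_power_trans unfolding strict_power_def comparable_def by blast

end

section \<open>The direction of an edge\<close>

text \<open>
  Only elements of infinite order are considered: among torsion elements forming a chain the graph
  is complete and contains no information about directions.
\<close>
definition power_digraph_iso ::
    "('a, 'm) monoid_scheme \<Rightarrow> ('b, 'n) monoid_scheme \<Rightarrow> ('a \<Rightarrow> 'b) \<Rightarrow> bool" where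
  "power_digraph_iso K L f \<longleftrightarrow> bij_betw f (nontorsion K) (nontorsion L) \<and>
     (\<forall>x\<in>nontorsion K. \<forall>y\<in>nontorsion K. has_power L (f x) (f y) \<longleftrightarrow> has_power K x y)"

text \<open>
  The strict roots of an element and its strict powers are told apart from each other by
  incomparability, so \<open>f\<close> keeps or reverses the direction at each element separately. A
  reversal at one element is inherited by its strict roots, and then the common power of the images
  of two roots comes from a common root of these, which the hypothesis about roots excludes for a
  suitable pair.
\<close>
lemma comparability_iso_preserves_direction:
  fixes K :: "('a, 'm) monoid_scheme" and L :: "('b, 'n) monoid_scheme"
  assumes "group K" "group L"
    and div: "divisible_set K (carrier K)"
    and no_common_root: "\<And>x. x \<in> nontorsion K \<Longrightarrow> \<exists>y\<in>carrier K. \<exists>z\<in>carrier K.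
          strict_power K y x \<and> strict_power K z x \<and> \<not> common_root K y z"
    and bij: "bij_betw f (nontorsion K) (nontorsion L)"
    and cmp: "\<And>x y. x \<in> nontorsion K \<Longrightarrow> y \<in> nontorsion K \<Longrightarrow>
          comparable L (f x) (f y) \<longleftrightarrow> comparable K x y"
  shows "power_digraph_iso K L f"
proof -
  interpret K: group K by fact
  interpret L: group L by fact
  note Kc = K.nontorsion_carrier
  note Lc = L.nontorsion_carrier
  have fL: "f x \<in> nontorsion L" if "x \<in> nontorsion K" for x
    using bij that by (rule bij_betwE[THEN bspec])
  have ex_f: "\<exists>x\<in>nontorsion K. f x = u" if "u \<in> nontorsion L" for u
    using bij that by (metis bij_betw_imp_surj_on imageE)
  have KP: "y \<in> nontorsion K" if "x \<in> nontorsion K" "strict_power K x y" for x y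
    using that K.has_power_nontorsion_iff Kc by (auto simp: strict_power_def)
  have KR: "y \<in> nontorsion K" if "x \<in> nontorsion K" "y \<in> carrier K" "strict_power K y x" for x y
    using that K.has_power_nontorsion_iff by (auto simp: strict_power_def)
  have LP: "y \<in> nontorsion L" if "x \<in> nontorsion L" "strict_power L x y" for x y
    using that L.has_power_nontorsion_iff Lc by (auto simp: strict_power_def)

  \<comment> \<open>Mutual powers are recognised among comparable pairs by having the same comparable elements.\<close>
  have mutual: "has_power K x y \<and> has_power K y x \<longleftrightarrow> has_power L (f x) (f y) \<and> has_power L (f y) (f x)"
    if x: "x \<in> nontorsion K" and y: "y \<in> nontorsion K" for x y
  proof
    assume xy: "has_power K x y \<and> has_power K y x"
    then have same: "comparable K z x \<longleftrightarrow> comparable K z y" if "z \<in> nontorsion K" for z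
      unfolding comparable_def using K.has_power_trans that x y Kc by meson
    have same': "comparable L w (f x) \<longleftrightarrow> comparable L w (f y)" if "w \<in> nontorsion L" for w
      using ex_f[OF that] same cmp x y by blast
    have "comparable L (f x) (f y)" using cmp x y xy by (auto simp: comparable_def)
    then show "has_power L (f x) (f y) \<and> has_power L (f y) (f x)"
      using L.same_comparables_imp_mutual_powers same' fL[OF x] fL[OF y]
      unfolding comparable_def[of L "f x" "f y"] by metis
  next
    assume xy: "has_power L (f x) (f y) \<and> has_power L (f y) (f x)"
    have fx: "f x \<in> nontorsion L" "f y \<in> nontorsion L" using fL x y by auto
    have same': "comparable L w (f x) \<longleftrightarrow> comparable L w (f y)" if "w \<in> nontorsion L" for w
      unfolding comparable_def using L.has_power_trans that fx Lc xy by meson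
    have same: "comparable K z x \<longleftrightarrow> comparable K z y" if "z \<in> nontorsion K" for z
      using same'[OF fL[OF that]] cmp x y that by blast
    have "comparable K x y" using cmp x y xy by (auto simp: comparable_def)
    then show "has_power K x y \<and> has_power K y x"
      using K.same_comparables_imp_mutual_powers same x y
      unfolding comparable_def[of K x y] by metis
  qed
  have nbr: "strict_power K x y \<or> strict_power K y x \<longleftrightarrow>
      strict_power L (f x) (f y) \<or> strict_power L (f y) (f x)"
    if "x \<in> nontorsion K" "y \<in> nontorsion K" for x y
    using mutual[OF that] cmp[OF that] by (auto simp: strict_power_def comparable_def)

  have sideL: "strict_power L (f x) (f y) \<longleftrightarrow> strict_power L (f x) (f z)"
    if "x \<in> nontorsion K" "y \<in> nontorsion K" "z \<in> nontorsion K"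
      "strict_power K x y \<or> strict_power K y x" "strict_power K x z \<or> strict_power K z x"
      "\<not> comparable K y z" for x y z
    using that nbr cmp fL Lc by (intro L.incomparable_strict_neighbours_same_side) blast+
  have powers_same: "strict_power L (f x) (f y) \<longleftrightarrow> strict_power L (f x) (f z)"
    if x: "x \<in> nontorsion K" and y: "strict_power K x y" and z: "strict_power K x z" for x y z
  proof -
    obtain w where "strict_power K x w" "\<not> comparable K w y" "\<not> comparable K w z"
      using K.strict_powers_share_incomparable[OF x y z] .
    then show ?thesis using sideL[of x w y] sideL[of x w z] KP[OF x] x y z by blast
  qed
  have roots_same: "strict_power L (f x) (f y) \<longleftrightarrow> strict_power L (f x) (f z)"
    if x: "x \<in> nontorsion K" and y: "y \<in> carrier K" "strict_power K y x"
      and z: "z \<in> carrier K" "strict_power K z x" for x y z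
  proof -
    obtain w where "w \<in> carrier K" "strict_power K w x" "\<not> comparable K w y" "\<not> comparable K w z"
      using K.strict_roots_share_incomparable[OF div x y z] .
    then show ?thesis using sideL[of x w y] sideL[of x w z] KR[OF x] x y z by blast
  qed
  have back_same: "strict_power K x y \<longleftrightarrow> strict_power K x z"
    if x: "x \<in> nontorsion K" and y: "y \<in> nontorsion K" "strict_power L (f x) (f y)"
      and z: "z \<in> nontorsion K" "strict_power L (f x) (f z)" for x y z
  proof -
    obtain v where v: "strict_power L (f x) v" "\<not> comparable L v (f y)" "\<not> comparable L v (f z)"
      using L.strict_powers_share_incomparable[OF fL[OF x] y(2) z(2)] .
    then obtain w where w: "w \<in> nontorsion K" "f w = v"
      using LP[OF fL[OF x]] ex_f by blast
    have "strict_power K x w \<or> strict_power K w x" "strict_power K x y \<or> strict_power K y x"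
      "strict_power K x z \<or> strict_power K z x" "\<not> comparable K w y" "\<not> comparable K w z"
      using nbr cmp w v x y z by blast+
    then show ?thesis
      using K.incomparable_strict_neighbours_same_side[of w y x]
        K.incomparable_strict_neighbours_same_side[of w z x] Kc w y z by blast
  qed

  \<comment> \<open>If no strict power of \<open>x\<close> is sent to a strict power of \<open>f x\<close>, then such powers come from strict roots.\<close>
  have dichotomy: "(\<forall>y\<in>nontorsion K. strict_power K x y \<longrightarrow> strict_power L (f x) (f y)) \<or>
     (\<forall>y\<in>nontorsion K. (strict_power K x y \<longrightarrow> strict_power L (f y) (f x)) \<and>
                     (strict_power K y x \<longrightarrow> strict_power L (f x) (f y)))"
    (is "?keep \<or> ?reverse") if x: "x \<in> nontorsion K" for x
  proof (cases "\<exists>y\<in>nontorsion K. strict_power K x y \<and> strict_power L (f x) (f y)")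
    case True
    then show ?thesis using powers_same[OF x] by blast
  next
    case False
    have "strict_power L (f x) (f x [^]\<^bsub>L\<^esub> (2::int))"
      using L.strict_power_powI[OF fL[OF x], of 2] by simp
    then obtain u where u: "u \<in> nontorsion K" "strict_power L (f x) (f u)"
      using LP[OF fL[OF x]] ex_f by metis
    then have "strict_power K u x" using False nbr x by blast
    then have "?reverse"
      using False nbr[OF x] roots_same[OF x, of u] u Kc by blast
    then show ?thesis by blast
  qed

  have keep: "strict_power L (f x) (f y)" if x: "x \<in> nontorsion K" and xy: "strict_power K x y" for x y
  proof (rule ccontr)
    assume contr: "\<not> strict_power L (f x) (f y)"
    have rev: "strict_power L (f x) (f u)" if "u \<in> carrier K" "strict_power K u x" for u
      using dichotomy[OF x] contr xy KP[OF x] KR[OF x] that by blast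
    have rev': "strict_power L (f u) (f w)"
      if u: "u \<in> carrier K" "strict_power K u x" and w: "w \<in> carrier K" "strict_power K w u" for u w
    proof -
      have "u \<in> nontorsion K" using u KR[OF x] by blast
      moreover have "\<not> strict_power L (f u) (f x)"
        using rev[OF u] by (simp add: strict_power_def)
      ultimately show ?thesis using dichotomy[of u] u w KR x by blast
    qed
    obtain u v where u: "u \<in> carrier K" "strict_power K u x" and v: "v \<in> carrier K" "strict_power K v x"
      and uv: "\<not> common_root K u v"
      using no_common_root[OF x] by blast
    have un: "u \<in> nontorsion K" and vn: "v \<in> nontorsion K" using u v KR x by blast+
    obtain i :: int where i: "f u = f x [^]\<^bsub>L\<^esub> i" "\<bar>i\<bar> \<ge> 2"
      using fL[OF x] rev[OF u] by (rule L.strict_power_pow)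
    obtain j :: int where j: "f v = f x [^]\<^bsub>L\<^esub> j" "\<bar>j\<bar> \<ge> 2"
      using fL[OF x] rev[OF v] by (rule L.strict_power_pow)
    \<comment> \<open>A common power of \<open>f u\<close> and \<open>f v\<close> that is strict for both.\<close>
    define g where "g = f x [^]\<^bsub>L\<^esub> (i * j)"
    have gu: "g = f u [^]\<^bsub>L\<^esub> j" and gv: "g = f v [^]\<^bsub>L\<^esub> i"
      using i j fL[OF x] Lc by (simp_all add: g_def L.int_pow_pow mult.commute)
    have sg: "strict_power L (f u) g" "strict_power L (f v) g"
      using L.strict_power_powI fL un vn i(2) j(2) gu gv by metis+
    obtain h where h: "h \<in> nontorsion K" "f h = g"
      using LP[OF fL[OF un] sg(1)] ex_f by blast
    have "has_power K h w" if w: "w \<in> carrier K" "strict_power K w x" "strict_power L (f w) g" for w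
    proof -
      have wn: "w \<in> nontorsion K" using w KR x by blast
      have "\<not> strict_power K w h"
      proof
        assume wh: "strict_power K w h"
        have "strict_power L (f w) (f x)"
          using powers_same[OF wn wh w(2)] h w(3) by simp
        then show False using rev[OF w(1,2)] by (simp add: strict_power_def)
      qed
      then show ?thesis
        using nbr[OF wn h(1)] w(3) h(2) by (auto simp: strict_power_def)
    qed
    then show False using uv u v sg h(1) Kc unfolding common_root_def by blast
  qed

  have "has_power L (f x) (f y) \<longleftrightarrow> has_power K x y"
    if x: "x \<in> nontorsion K" and y: "y \<in> nontorsion K" for x y
    using keep[OF x, of y] keep[OF y, of x] mutual[OF x y] nbr[OF x y]
    by (auto simp: strict_power_def)
  then show ?thesis using bij by (simp add: power_digraph_iso_def)
qed

lemma power_digraph_iso_inverse: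
  assumes "power_digraph_iso K L f"
  shows "power_digraph_iso L K (inv_into (nontorsion K) f)"
proof -
  have bij: "bij_betw f (nontorsion K) (nontorsion L)"
    using assms by (simp add: power_digraph_iso_def)
  let ?g = "inv_into (nontorsion K) f"
  have "?g u \<in> nontorsion K" "f (?g u) = u" if "u \<in> nontorsion L" for u
    using bij that bij_betw_inv_into_right[of f] bij_betw_apply[OF bij_betw_inv_into[OF bij]] by auto
  then show ?thesis
    using assms bij_betw_inv_into[OF bij] unfolding power_digraph_iso_def by metis
qed

section \<open>Prime exponents\<close>

text \<open>
  Cover relation of the power preorder on elements of infinite order; it is defined without
  exponents, which makes it invariant under \<open>power_digraph_iso\<close>.
\<close>
definition prime_step :: "('a, 'm) monoid_scheme \<Rightarrow> 'a \<Rightarrow> 'a \<Rightarrow> bool" where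
  "prime_step K x y \<longleftrightarrow> strict_power K x y \<and>
     (\<forall>z\<in>nontorsion K. has_power K x z \<and> has_power K z y \<longrightarrow> has_power K z x \<or> has_power K y z)"

text \<open>
  Below an element of infinite order the power preorder is divisibility of exponents, whose covers
  of 1 are the primes up to sign.
\<close>
lemma (in group) prime_step_pow_iff:
  assumes x: "x \<in> nontorsion G" and "k \<noteq> 0"
  shows "prime_step G x (x [^] (k::int)) \<longleftrightarrow> prime \<bar>k\<bar>"
proof
  assume step: "prime_step G x (x [^] k)"
  then have "\<not> k dvd 1"
    using has_power_pow_pow_iff[of x k 1] assms
    by (simp add: prime_step_def strict_power_def nontorsion_carrier)
  then have "\<bar>k\<bar> > 1" using assms(2) by auto
  moreover have "m = 1 \<or> m = \<bar>k\<bar>" if m: "m \<ge> 0" "m dvd \<bar>k\<bar>" for m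
  proof -
    have m0: "m \<noteq> 0" "m dvd k" using m assms(2) by auto
    then have "has_power G x (x [^] m)" "has_power G (x [^] m) (x [^] k)"
      using x assms(2) by (simp_all add: has_power_pow_pow_iff has_power_pow)
    then have "has_power G (x [^] m) x \<or> has_power G (x [^] k) (x [^] m)"
      using step nontorsion_pow[OF x m0(1)] by (simp add: prime_step_def)
    then have "m dvd 1 \<or> k dvd m"
      using has_power_pow_pow_iff[of x m 1] has_power_pow_pow_iff[of x k m] x m0 assms(2)
      by (simp add: nontorsion_carrier)
    then show ?thesis using m m0 by (auto intro: zdvd_antisym_nonneg)
  qed
  ultimately show "prime \<bar>k\<bar>" by (auto simp: prime_int_iff)
next
  assume k: "prime \<bar>k\<bar>"
  then have "\<bar>k\<bar> \<ge> 2" using prime_ge_2_int by blast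
  moreover have "has_power G z x \<or> has_power G (x [^] k) z"
    if xz: "has_power G x z" and zk: "has_power G z (x [^] k)" for z
  proof -
    obtain i :: int where i: "i \<noteq> 0" "z = x [^] i" using xz by (auto simp: has_power_def)
    have "\<bar>i\<bar> dvd \<bar>k\<bar>"
      using zk has_power_pow_pow_iff x i assms(2) by simp
    then have "\<bar>i\<bar> = 1 \<or> \<bar>i\<bar> = \<bar>k\<bar>" using k by (auto simp: prime_int_iff)
    then have "i dvd 1 \<or> k dvd i" by (metis abs_dvd_iff dvd_abs_iff dvd_refl)
    then show ?thesis
      using has_power_pow_pow_iff[of x i 1] has_power_pow_pow_iff[of x k i] x i assms(2)
      by (simp add: nontorsion_carrier)
  qed
  ultimately show "prime_step G x (x [^] k)"
    using strict_power_powI[OF x] by (simp add: prime_step_def)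
qed

text \<open>
  In the cyclic group generated by a common root, \<open>n\<close>-th roots are unique.
\<close>
lemma (in group) equal_if_common_root:
  assumes x: "x [^] (n::int) \<in> nontorsion G" and eq: "y [^] n = x [^] n"
    and carr: "x \<in> carrier G" "y \<in> carrier G" and root: "common_root G x y"
  shows "x = y"
proof -
  obtain c i j where c: "c \<in> carrier G" "x = c [^] (i::int)" "y = c [^] (j::int)"
    using root by (auto simp: common_root_def has_power_def)
  have "n \<noteq> 0"
    using x by (auto simp: nontorsion_def torsion_def dest: spec[of _ "1::int"])
  have "c \<in> nontorsion G"
    using x c unfolding nontorsion_def by (auto dest: torsion_pow)
  moreover have "c [^] (j * n) = c [^] (i * n)" using eq c by (simp add: int_pow_pow)
  ultimately show ?thesis using \<open>n \<noteq> 0\<close> c by (simp add: nontorsion_pow_eq_iff)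
qed

text \<open>
  By Bezout, with \<open>u i + v j = 1\<close>, the element \<open>x\<^sup>v y\<^sup>u\<close> has
  \<open>j\<close>-th power \<open>x\<close> and \<open>i\<close>-th power \<open>y\<close>.
\<close>
lemma (in comm_group) coprime_roots_have_common_root:
  assumes carr: "x \<in> carrier G" "y \<in> carrier G" and eq: "x [^] (i::int) = y [^] (j::int)"
    and ij: "coprime i j" "i \<noteq> 0" "j \<noteq> 0"
  shows "common_root G x y"
proof -
  obtain u v where uv: "u * i + v * j = 1" using bezout_int[of i j] ij(1) by auto
  define c where "c = x [^] v \<otimes> y [^] u"
  have "c [^] j = (x [^] v) [^] j \<otimes> (y [^] j) [^] u"
    using carr by (simp add: c_def int_pow_distrib int_pow_pow mult.commute)
  also have "\<dots> = (x [^] v) [^] j \<otimes> (x [^] i) [^] u" by (simp only: eq)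
  also have "\<dots> = x [^] (u * i + v * j)"
    using carr by (simp add: int_pow_pow int_pow_mult[symmetric] ac_simps)
  finally have "c [^] j = x" using uv carr by simp
  moreover have "c [^] i = (x [^] i) [^] v \<otimes> (y [^] u) [^] i"
    using carr by (simp add: c_def int_pow_distrib int_pow_pow mult.commute)
  then have "c [^] i = (y [^] j) [^] v \<otimes> (y [^] u) [^] i" by (simp only: eq)
  then have "c [^] i = y [^] (u * i + v * j)"
    using carr by (simp add: int_pow_pow int_pow_mult[symmetric] ac_simps)
  then have "c [^] i = y" using uv carr by simp
  moreover have "c \<in> carrier G" using carr by (simp add: c_def)
  ultimately show ?thesis unfolding common_root_def has_power_def using ij by metis
qed

lemma power_digraph_iso_nontorsion:
  "power_digraph_iso K L f \<Longrightarrow> x \<in> nontorsion K \<Longrightarrow> f x \<in> nontorsion L"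
  unfolding power_digraph_iso_def by (blast dest: bij_betwE)

lemma power_digraph_iso_surj:
  assumes "power_digraph_iso K L f" "u \<in> nontorsion L"
  obtains x where "x \<in> nontorsion K" "f x = u"
  using assms unfolding power_digraph_iso_def by (metis bij_betw_imp_surj_on imageE)

lemma power_digraph_iso_has_power:
  "power_digraph_iso K L f \<Longrightarrow> x \<in> nontorsion K \<Longrightarrow> y \<in> nontorsion K \<Longrightarrow>
     has_power L (f x) (f y) \<longleftrightarrow> has_power K x y"
  by (simp add: power_digraph_iso_def)

lemma power_digraph_iso_prime_step:
  assumes f: "power_digraph_iso K L f" and x: "x \<in> nontorsion K" and y: "y \<in> nontorsion K"
  shows "prime_step L (f x) (f y) \<longleftrightarrow> prime_step K x y"
proof -
  have "(\<forall>u\<in>nontorsion L. P u) \<longleftrightarrow> (\<forall>z\<in>nontorsion K. P (f z))" for P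
    using power_digraph_iso_surj[OF f] power_digraph_iso_nontorsion[OF f] by metis
  then show ?thesis
    using x y by (simp add: prime_step_def strict_power_def power_digraph_iso_has_power[OF f])
qed

lemma power_digraph_iso_common_root:
  assumes "group K" "group L" and f: "power_digraph_iso K L f"
    and x: "x \<in> nontorsion K" and y: "y \<in> nontorsion K"
  shows "common_root L (f x) (f y) \<longleftrightarrow> common_root K x y"
proof -
  interpret K: group K by fact
  interpret L: group L by fact
  have K: "common_root K x y \<longleftrightarrow> (\<exists>z\<in>nontorsion K. has_power K z x \<and> has_power K z y)"
    using K.has_power_nontorsion_iff x K.nontorsion_carrier unfolding common_root_def by blast
  have L: "common_root L (f x) (f y) \<longleftrightarrow> (\<exists>z\<in>nontorsion L. has_power L z (f x) \<and> has_power L z (f y))"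
    using L.has_power_nontorsion_iff power_digraph_iso_nontorsion[OF f x] L.nontorsion_carrier
    unfolding common_root_def by blast
  show ?thesis
    unfolding K L using power_digraph_iso_surj[OF f] power_digraph_iso_nontorsion[OF f]
      power_digraph_iso_has_power[OF f] x y by metis
qed

text \<open>
  The \<open>l\<close>-th roots of \<open>a\<close> have pairwise no common root, and
  \<open>f\<close> preserves this. In the abelian group \<open>L\<close>, roots of coprime exponents
  do have a common root, so the images of the \<open>l\<close>-th roots are, up to inversion, all
  roots of \<open>f a\<close> for one and the same prime. Their quotients are torsion elements
  killed by that prime.
\<close>
lemma prime_roots_inject_into_torsion:
  assumes "group K" "comm_group L" and f: "power_digraph_iso K L f"
    and a: "a \<in> nontorsion K" and l: "prime (l::int)"
  shows "\<exists>(q::int) h. prime q \<and> inj_on h {z \<in> carrier K. z [^]\<^bsub>K\<^esub> l = a} \<and>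
           h ` {z \<in> carrier K. z [^]\<^bsub>K\<^esub> l = a} \<subseteq> {t \<in> carrier L. t [^]\<^bsub>L\<^esub> q = \<one>\<^bsub>L\<^esub>}"
proof (cases "{z \<in> carrier K. z [^]\<^bsub>K\<^esub> l = a} = {}")
  case True
  moreover have "prime (2::int)" by simp
  ultimately show ?thesis by (metis empty_subsetI image_empty inj_on_empty)
next
  case False
  define S where "S = {z \<in> carrier K. z [^]\<^bsub>K\<^esub> l = a}"
  interpret K: group K by fact
  interpret L: comm_group L by fact
  note fL = power_digraph_iso_nontorsion[OF f]
  have l0: "l > 0" using prime_ge_2_int[OF l] by simp
  have Sn: "z \<in> nontorsion K" if "z \<in> S" for z
    using that a K.has_power_nontorsion_iff[of z] K.has_power_pow[of l z] l0 by (auto simp: S_def)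
  have fSc: "f z \<in> carrier L" if "z \<in> S" for z using Sn[OF that] fL L.nontorsion_carrier by blast
  have no_root: "\<not> common_root L (f y) (f z)" if "y \<in> S" "z \<in> S" "y \<noteq> z" for y z
    using K.equal_if_common_root[of y l z] that a power_digraph_iso_common_root[OF \<open>group K\<close> _ f Sn Sn, of y z]
      L.is_group
    by (auto simp: S_def)
  have exponent: "\<exists>k::int. k \<noteq> 0 \<and> prime \<bar>k\<bar> \<and> f z [^]\<^bsub>L\<^esub> k = f a" if "z \<in> S" for z
  proof -
    have "prime_step K z a"
      using K.prime_step_pow_iff[OF Sn[OF that], of l] l0 l that by (simp add: S_def)
    then have step: "prime_step L (f z) (f a)"
      using power_digraph_iso_prime_step[OF f Sn[OF that] a] by simp
    then obtain k :: int where "k \<noteq> 0" "f a = f z [^]\<^bsub>L\<^esub> k"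
      by (auto simp: prime_step_def strict_power_def has_power_def)
    then show ?thesis using L.prime_step_pow_iff[OF fL[OF Sn[OF that]]] step by metis
  qed
  obtain y where y: "y \<in> S" using False by (auto simp: S_def)
  obtain k :: int where k: "k \<noteq> 0" "prime \<bar>k\<bar>" "f y [^]\<^bsub>L\<^esub> k = f a" using exponent[OF y] by blast
  \<comment> \<open>The exponents of two images are primes up to sign; being not coprime, they agree up to sign.\<close>
  have "\<exists>e::int. \<bar>e\<bar> = 1 \<and> (f z [^]\<^bsub>L\<^esub> e) [^]\<^bsub>L\<^esub> k = f a" if z: "z \<in> S" for z
  proof (cases "z = y")
    case True
    then show ?thesis using k fSc[OF y] by (intro exI[of _ 1]) simp
  next
    case False
    obtain m :: int where m: "m \<noteq> 0" "prime \<bar>m\<bar>" "f z [^]\<^bsub>L\<^esub> m = f a" using exponent[OF z] by blast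
    have "\<not> coprime m k"
      using no_root[OF z y False] L.coprime_roots_have_common_root[of "f z" "f y" m k] fSc y z m k by auto
    then have "\<bar>m\<bar> = \<bar>k\<bar>"
      using primes_coprime[OF m(2) k(2)] by auto
    then have "m = k \<or> m = - k" by linarith
    then have "m = sgn m * sgn k * k \<and> \<bar>sgn m * sgn k\<bar> = 1" using k(1) by (auto simp: sgn_if)
    then show ?thesis using m(3) L.int_pow_pow[OF fSc[OF z]] by metis
  qed
  then obtain e :: "'a \<Rightarrow> int" where
    e: "\<And>z. z \<in> S \<Longrightarrow> \<bar>e z\<bar> = 1" "\<And>z. z \<in> S \<Longrightarrow> (f z [^]\<^bsub>L\<^esub> e z) [^]\<^bsub>L\<^esub> k = f a"
    by metis
  define h where "h z = f z [^]\<^bsub>L\<^esub> e z \<otimes>\<^bsub>L\<^esub> inv\<^bsub>L\<^esub> (f y)" for z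
  have "inj_on h S"
  proof (rule inj_onI, rule ccontr)
    fix z w assume zw: "z \<in> S" "w \<in> S" "h z = h w" "z \<noteq> w"
    then have "f z [^]\<^bsub>L\<^esub> e z = f w [^]\<^bsub>L\<^esub> e w"
      using fSc y by (simp add: h_def)
    moreover have "coprime (e z) (e w)" "e z \<noteq> 0" "e w \<noteq> 0"
      using e(1)[OF zw(1)] e(1)[OF zw(2)] by (auto simp: abs_if split: if_splits)
    ultimately show False
      using no_root[OF zw(1,2,4)] L.coprime_roots_have_common_root fSc zw by blast
  qed
  moreover have "h z \<in> carrier L \<and> h z [^]\<^bsub>L\<^esub> \<bar>k\<bar> = \<one>\<^bsub>L\<^esub>" if "z \<in> S" for z
  proof
    show hc: "h z \<in> carrier L" using fSc that y by (simp add: h_def)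
    have "h z [^]\<^bsub>L\<^esub> k = f a \<otimes>\<^bsub>L\<^esub> inv\<^bsub>L\<^esub> (f a)"
      using fSc[OF that] fSc[OF y] e(2)[OF that] k(3)
      by (simp add: h_def L.int_pow_distrib L.int_pow_inv)
    then have "h z [^]\<^bsub>L\<^esub> k = \<one>\<^bsub>L\<^esub>" using fL[OF a] L.nontorsion_carrier by simp
    then show "h z [^]\<^bsub>L\<^esub> \<bar>k\<bar> = \<one>\<^bsub>L\<^esub>" using hc by (simp add: abs_if L.int_pow_neg)
  qed
  ultimately show ?thesis using k(2) unfolding S_def by blast
qed

lemma (in group) divisible_setI_prime:
  assumes A: "A \<subseteq> carrier G"
    and "\<And>x l. x \<in> A \<Longrightarrow> prime (l::int) \<Longrightarrow> \<exists>y\<in>A. y [^] l = x"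
  shows "divisible_set G A"
  unfolding divisible_set_def
proof (intro ballI allI impI)
  have "\<exists>y\<in>A. y [^] (int n) = x" if "x \<in> A" "n > 0" for x n
    using that
  proof (induction n arbitrary: x rule: less_induct)
    case (less n)
    show ?case
    proof (cases "n = 1")
      case True
      then show ?thesis using less A by (auto intro!: bexI[of _ x])
    next
      case False
      obtain l where l: "prime l" "l dvd n" using prime_factor_nat[OF False] by blast
      then obtain m where m: "n = l * m" by blast
      with l less have "m > 0" "m < n" using prime_gt_1_nat[OF l(1)] by auto
      obtain y where y: "y \<in> A" "y [^] int l = x" using assms(2)[of x "int l"] l less by auto
      obtain z where "z \<in> A" "z [^] int m = y" using less.IH \<open>m > 0\<close> \<open>m < n\<close> y by blast
      then show ?thesis using y A m by (intro bexI[of _ z]) (auto simp: int_pow_pow mult.commute)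
    qed
  qed
  note * = this
  fix x and n :: int assume "x \<in> A" "n > 0"
  then show "\<exists>y\<in>A. y [^] n = x" using *[of x "nat n"] by simp
qed

section \<open>Divisible locally cyclic subsets\<close>

text \<open>
  Together with the identity, \<open>A\<close> is a divisible, torsion-free, locally cyclic
  subgroup, that is, a copy of the rationals. The identity is left out so that \<open>A\<close> lies
  in the domain of a \<open>power_digraph_iso\<close>.
\<close>
definition rational_spine :: "('a, 'm) monoid_scheme \<Rightarrow> 'a set \<Rightarrow> bool" where
  "rational_spine K A \<longleftrightarrow> A \<noteq> {} \<and> A \<subseteq> nontorsion K \<and> divisible_set K A \<and>
     (\<forall>x\<in>A. \<forall>n::int. n \<noteq> 0 \<longrightarrow> x [^]\<^bsub>K\<^esub> n \<in> A) \<and>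
     (\<forall>x\<in>A. \<forall>y\<in>A. \<exists>z\<in>A. has_power K z x \<and> has_power K z y)"

lemma (in group) root_chain_eq_pow:
  assumes "\<And>k. s k \<in> carrier G" "\<And>k. s (Suc k) [^] (e k :: int) = s k" and "k \<le> l"
  shows "s k = s l [^] (\<Prod>i=k..<l. e i)"
  using \<open>k \<le> l\<close>
proof (induction l rule: dec_induct)
  case base
  then show ?case using assms(1) by simp
next
  case (step l)
  have "s k = (s (Suc l) [^] e l) [^] (\<Prod>i=k..<l. e i)" using step.IH assms(2) by simp
  also have "\<dots> = s (Suc l) [^] (\<Prod>i=k..<Suc l. e i)"
    using assms(1) step.hyps by (simp add: int_pow_pow mult.commute)
  finally show ?case .
qed

lemma (in group) divisible_root_chain:
  assumes "divisible_set G (carrier G)" "x \<in> carrier G"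
  obtains s where "s 0 = x" "\<And>k. s k \<in> carrier G" "\<And>k. s (Suc k) [^] int (Suc k) = s k"
proof -
  have "\<exists>s. s 0 = x \<and> (\<forall>k. s k \<in> carrier G) \<and> (\<forall>k. s (Suc k) [^] int (Suc k) = s k)"
  proof -
    have "\<exists>s. \<forall>k. (s k \<in> carrier G \<and> (k = 0 \<longrightarrow> s k = x)) \<and> s (Suc k) [^] int (Suc k) = s k"
    proof (rule dependent_nat_choice)
      show "\<exists>y. y \<in> carrier G \<and> (0 = (0::nat) \<longrightarrow> y = x)" using assms by auto
      fix y k assume "y \<in> carrier G \<and> (k = (0::nat) \<longrightarrow> y = x)"
      then show "\<exists>z. (z \<in> carrier G \<and> (Suc k = 0 \<longrightarrow> z = x)) \<and> z [^] int (Suc k) = y"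
        using assms(1) unfolding divisible_set_def
        by (metis Zero_not_Suc of_nat_0_less_iff zero_less_Suc)
    qed
    then show ?thesis by blast
  qed
  then show thesis using that by blast
qed

text \<open>
  The chain mimics the elements \<open>1 / k!\<close> of the rationals.
\<close>
lemma (in group) rational_spine_exists:
  assumes div: "divisible_set G (carrier G)" and x: "x \<in> nontorsion G"
  obtains s where "\<forall>k. s k \<in> nontorsion G" "\<forall>k. s (Suc k) [^] int (Suc k) = s k"
    "rational_spine G {y. \<exists>k. has_power G (s k) y}"
proof -
  obtain s where s: "s 0 = x" "\<And>k. s k \<in> carrier G" "\<And>k. s (Suc k) [^] int (Suc k) = s k"
    using divisible_root_chain[OF div] x nontorsion_carrier by metis
  have desc: "has_power G (s l) (s k)" if "k \<le> l" for k l
  proof -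
    have "s k = s l [^] (\<Prod>i=k..<l. int (Suc i))"
      using s(2,3) that by (rule root_chain_eq_pow)
    moreover have "(\<Prod>i=k..<l. int (Suc i)) \<noteq> 0" by simp
    ultimately show ?thesis unfolding has_power_def by blast
  qed
  define A where "A = {y. \<exists>k. has_power G (s k) y}"
  have sn: "s k \<in> nontorsion G" for k
    using desc[of 0 k] s x has_power_nontorsion_iff by auto
  have "\<exists>z\<in>A. z [^] n = y" if y: "y \<in> A" and n: "n > 0" for y and n :: int
  proof -
    obtain k j where j: "j \<noteq> 0" "y = s k [^] (j::int)"
      using y by (auto simp: A_def has_power_def)
    \<comment> \<open>The step of the chain with index \<open>n * (k + 1)\<close> comes after \<open>s k\<close> and is divisible by \<open>n\<close>.\<close>
    define l where "l = nat n * Suc k - 1"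
    have "1 * Suc k \<le> nat n * Suc k" using n by (intro mult_le_mono1) simp
    then have l: "Suc l = nat n * Suc k" "k \<le> l" by (simp_all add: l_def)
    obtain i where i: "i \<noteq> 0" "s k = s l [^] (i::int)"
      using desc[OF l(2)] by (auto simp: has_power_def)
    define z where "z = s (Suc l) [^] (int (Suc k) * i * j)"
    have "int (Suc l) = n * int (Suc k)" using l(1) n by (metis int_nat_eq of_nat_mult less_imp_le)
    then have "s l = s (Suc l) [^] (n * int (Suc k))" using s(3)[of l] by simp
    then have "z [^] n = y" using s(2) by (simp add: z_def i j int_pow_pow ac_simps)
    moreover have "z \<in> A" unfolding A_def z_def using i j by (auto intro!: exI[of _ "Suc l"] has_power_pow)
    ultimately show ?thesis by blast
  qed
  then have "divisible_set G A" by (simp add: divisible_set_def)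
  moreover have "\<exists>z\<in>A. has_power G z y \<and> has_power G z y'" if "y \<in> A" "y' \<in> A" for y y'
  proof -
    obtain k k' where "has_power G (s k) y" "has_power G (s k') y'"
      using \<open>y \<in> A\<close> \<open>y' \<in> A\<close> by (auto simp: A_def)
    then have "has_power G (s (max k k')) y" "has_power G (s (max k k')) y'"
      using desc[of k "max k k'"] desc[of k' "max k k'"] has_power_trans s(2) by (meson max.cobounded1 max.cobounded2)+
    moreover have "s (max k k') \<in> A" using s(2) has_power_refl by (auto simp: A_def)
    ultimately show ?thesis by blast
  qed
  moreover have "A \<noteq> {}" using s(2) has_power_refl by (auto simp: A_def)
  moreover have "A \<subseteq> nontorsion G" using has_power_nontorsion_iff s(2) sn by (auto simp: A_def)
  moreover have "y [^] n \<in> A" if "y \<in> A" "n \<noteq> 0" for y and n :: int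
  proof -
    obtain k where "has_power G (s k) y" using \<open>y \<in> A\<close> unfolding A_def by blast
    then have "has_power G (s k) (y [^] n)"
      using has_power_trans[OF s(2)] has_power_pow[OF \<open>n \<noteq> 0\<close>] by blast
    then show ?thesis unfolding A_def by blast
  qed
  ultimately have "rational_spine G A" by (simp add: rational_spine_def)
  then show thesis using sn s(3) that[of s] unfolding A_def by blast
qed

text \<open>
  Divisibility is the only property that does not carry over at once, since \<open>f\<close> does
  not preserve exponents. To find an \<open>l\<close>-th root of \<open>a = f x\<close>, pull the
  prime step from \<open>a\<close> to its \<open>l\<close>-th power back to a step of prime exponent
  \<open>k\<close> starting in \<open>x\<close>, and prolong it in \<open>A\<close> by a
  \<open>k\<close>-th root \<open>z\<close> of \<open>x\<close>. Up to mutual powers,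
  \<open>z\<close>, \<open>x\<close> and the \<open>k\<close>-th power of \<open>x\<close> are the
  only elements between the first and the last of them. Hence the same holds for the images, which
  forces the exponent \<open>i\<close> with \<open>a = (f z)\<^sup>i\<close> to be a multiple of
  \<open>l\<close>.
\<close>
lemma power_digraph_iso_rational_spine:
  assumes "group K" "group L" and f: "power_digraph_iso K L f" and A: "rational_spine K A"
  shows "rational_spine L (f ` A)"
proof -
  interpret K: group K by fact
  interpret L: group L by fact
  note fL = power_digraph_iso_nontorsion[OF f]
  note fh = power_digraph_iso_has_power[OF f]
  have An: "x \<in> nontorsion K" if "x \<in> A" for x using A that by (auto simp: rational_spine_def)
  have Ap: "y \<in> A" if "x \<in> A" "has_power K x y" for x y
    using A that by (auto simp: rational_spine_def has_power_def)
  have img: "u \<in> f ` A" if x: "x \<in> A" and u: "has_power L (f x) u" for x u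
  proof -
    have "u \<in> nontorsion L"
      using L.has_power_nontorsion_iff u fL[OF An[OF x]] L.nontorsion_carrier by blast
    then obtain y where y: "y \<in> nontorsion K" "f y = u" using power_digraph_iso_surj[OF f] by blast
    then have "has_power K x y" using fh An x u by blast
    then show ?thesis using Ap x y by blast
  qed
  have "\<exists>c\<in>f ` A. c [^]\<^bsub>L\<^esub> l = a" if "a \<in> f ` A" and l: "prime l" for a and l :: int
  proof -
    obtain x where x: "x \<in> A" "a = f x" using \<open>a \<in> f ` A\<close> by blast
    have xn: "x \<in> nontorsion K" and an: "a \<in> nontorsion L" using x An fL by auto
    have l2: "l \<ge> 2" using l by (rule prime_ge_2_int)
    have "has_power L a (a [^]\<^bsub>L\<^esub> l)" using l2 by (intro L.has_power_pow) simp
    then obtain y where y: "y \<in> A" "f y = a [^]\<^bsub>L\<^esub> l" using img x by (metis imageE)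
    have yn: "y \<in> nontorsion K" using y An by blast
    have "prime_step L (f x) (f y)"
      using L.prime_step_pow_iff[OF an, of l] l l2 x y by simp
    then have step: "prime_step K x y" using power_digraph_iso_prime_step[OF f xn yn] by simp
    then obtain k where k: "k \<noteq> 0" "y = x [^]\<^bsub>K\<^esub> (k::int)"
      by (auto simp: prime_step_def strict_power_def has_power_def)
    have pk: "prime \<bar>k\<bar>" using K.prime_step_pow_iff[OF xn k(1)] step k(2) by simp
    then have k2: "\<bar>k\<bar> \<ge> 2" using prime_ge_2_int by blast
    obtain z where z: "z \<in> A" "z [^]\<^bsub>K\<^esub> \<bar>k\<bar> = x"
      using A x(1) k(1) unfolding rational_spine_def divisible_set_def by (metis zero_less_abs_iff)
    have zn: "z \<in> nontorsion K" and zc: "z \<in> carrier K" using z An K.nontorsion_carrier by auto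
    have yz: "y = z [^]\<^bsub>K\<^esub> (\<bar>k\<bar> * k)" using z k zc by (metis K.int_pow_pow)
    have "has_power K z x" using z k(1) K.has_power_pow[of "\<bar>k\<bar>" z] by simp
    then have "has_power L (f z) a" using fh zn xn x(2) by simp
    then obtain i :: int where i: "i \<noteq> 0" "a = f z [^]\<^bsub>L\<^esub> i" by (auto simp: has_power_def)
    have fzn: "f z \<in> nontorsion L" and fzc: "f z \<in> carrier L" using fL zn L.nontorsion_carrier by auto
    have "has_power L (f z) (f z [^]\<^bsub>L\<^esub> l)" using l2 by (intro L.has_power_pow) simp
    then obtain w where w: "w \<in> A" "f w = f z [^]\<^bsub>L\<^esub> l" using img z by (metis imageE)
    have wn: "w \<in> nontorsion K" using w An by blast
    have fy: "f y = f z [^]\<^bsub>L\<^esub> (i * l)" using y i fzc by (simp add: L.int_pow_pow)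
    have "has_power L (f z) (f w)" "has_power L (f w) (f y)"
      using L.has_power_pow_pow_iff[OF fzn, of l "i * l"] i l2 w fy
      by (simp_all add: L.has_power_pow)
    then have "has_power K z w" and wy: "has_power K w y" using fh zn wn yn by blast+
    then obtain j where j: "j \<noteq> 0" "w = z [^]\<^bsub>K\<^esub> (j::int)" by (auto simp: has_power_def)
    \<comment> \<open>\<open>w\<close> lies between \<open>z\<close> and \<open>y\<close>, so it is a mutual power of one of the three elements
        \<open>z\<close>, \<open>x\<close>, \<open>y\<close>, according to the exponent \<open>e\<close>.\<close>
    have "j dvd \<bar>k\<bar> * k"
      using wy K.has_power_pow_pow_iff[OF zn, of j "\<bar>k\<bar> * k"] j k yz by simp
    then have "\<bar>j\<bar> dvd \<bar>k\<bar>\<^sup>2"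
      by (metis abs_mult abs_abs dvd_abs_iff abs_dvd_iff power2_eq_square)
    then have "int (nat \<bar>j\<bar>) dvd int (nat \<bar>k\<bar> ^ 2)" by simp
    then have "nat \<bar>j\<bar> dvd nat \<bar>k\<bar> ^ 2" by (simp only: of_nat_dvd_iff)
    moreover have "prime (nat \<bar>k\<bar>)" using pk prime_int_nat_transfer by blast
    ultimately obtain e where e: "e \<le> 2" "nat \<bar>j\<bar> = nat \<bar>k\<bar> ^ e"
      using divides_primepow_nat by blast
    have "l dvd i"
    proof -
      consider "e = 0" | "e = 1" | "e = 2" using e(1) by linarith
      then show ?thesis
      proof cases
        case 1
        then have "j dvd 1" using e(2) by auto
        then have "has_power K w z"
          using K.has_power_pow_pow_iff[OF zn, of j 1] j zc by simp
        then have "has_power L (f w) (f z)" using fh wn zn by blast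
        then have "l dvd 1"
          using L.has_power_pow_pow_iff[OF fzn, of l 1] w(2) l2 fzc by simp
        then show ?thesis using l2 by auto
      next
        case 2
        then have "\<bar>j\<bar> = \<bar>k\<bar>" using e(2) by simp
        then have "j dvd \<bar>k\<bar>" by (metis abs_dvd_iff dvd_refl)
        then have "has_power K w x"
          using K.has_power_pow_pow_iff[OF zn, of j "\<bar>k\<bar>"] j k(1) z by simp
        then have "has_power L (f w) a" using fh wn xn x(2) by blast
        then show ?thesis
          using L.has_power_pow_pow_iff[OF fzn, of l i] w(2) l2 i by simp
      next
        case 3
        then have "int (nat \<bar>j\<bar>) = int (nat \<bar>k\<bar> ^ 2)" using e(2) by simp
        then have "\<bar>\<bar>k\<bar> * k\<bar> = \<bar>j\<bar>" by (simp add: abs_mult power2_eq_square)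
        then have "\<bar>k\<bar> * k dvd j" by (rule dvd_if_abs_eq)
        then have "has_power K y w"
          using K.has_power_pow_pow_iff[OF zn, of "\<bar>k\<bar> * k" j] j k(1) yz by simp
        then have "has_power L (f y) (f w)" using fh wn yn by blast
        then have "i * l dvd l"
          using L.has_power_pow_pow_iff[OF fzn, of "i * l" l] fy w(2) l2 i by simp
        then have "i dvd 1" using l2 by (simp add: mult_dvd_mono dvd_times_right_cancel_iff[of l i 1])
        then have "has_power L a (f z)"
          using L.has_power_pow_pow_iff[OF fzn, of i 1] i fzc by simp
        then have "has_power K x z" using fh xn zn x(2) by blast
        then have "\<bar>k\<bar> dvd 1"
          using K.has_power_pow_pow_iff[OF zn, of "\<bar>k\<bar>" 1] z(2) k(1) zc by simp
        then show ?thesis using k2 by simp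
      qed
    qed
    then obtain m where m: "i = l * m" by blast
    have "f z [^]\<^bsub>L\<^esub> m \<in> f ` A" using img[OF z(1)] i(1) m by (auto intro: L.has_power_pow)
    moreover have "(f z [^]\<^bsub>L\<^esub> m) [^]\<^bsub>L\<^esub> l = a" using i m fzc by (simp add: L.int_pow_pow mult.commute)
    ultimately show ?thesis by blast
  qed
  moreover have sub: "f ` A \<subseteq> nontorsion L" using fL An by blast
  ultimately have "divisible_set L (f ` A)"
    using L.nontorsion_carrier by (intro L.divisible_setI_prime) blast+
  moreover have "\<exists>z\<in>f ` A. has_power L z u \<and> has_power L z v" if uv: "u \<in> f ` A" "v \<in> f ` A" for u v
  proof -
    obtain x y where xy: "x \<in> A" "y \<in> A" "u = f x" "v = f y" using uv by blast
    then obtain z where z: "z \<in> A" "has_power K z x" "has_power K z y"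
      using A unfolding rational_spine_def by meson
    then have "has_power L (f z) u" "has_power L (f z) v" using fh An xy by simp_all
    then show ?thesis using z(1) by blast
  qed
  moreover have "u [^]\<^bsub>L\<^esub> n \<in> f ` A" if "u \<in> f ` A" "n \<noteq> 0" for u and n :: int
    using that img L.has_power_pow[OF that(2), of u] by fast
  moreover have "f ` A \<noteq> {}" using A by (auto simp: rational_spine_def)
  ultimately show ?thesis using sub unfolding rational_spine_def by blast
qed

section \<open>Torsion elements forming a chain\<close>

definition torsion_chain :: "('a, 'm) monoid_scheme \<Rightarrow> bool" where
  "torsion_chain K \<longleftrightarrow> infinite (torsion K) \<and> (\<forall>s\<in>torsion K. \<forall>t\<in>torsion K. comparable K s t)"

context group
begin

lemma eq_one_if_coprime_pows:
  assumes "x \<in> carrier G" "x [^] (m::int) = \<one>" "x [^] (n::int) = \<one>" "coprime m n"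
  shows "x = \<one>"
proof -
  obtain u v where uv: "u * m + v * n = 1" using bezout_int[of m n] assms(4) by auto
  have "x = x [^] (m * u + n * v)" using uv assms(1) by (simp add: mult.commute)
  also have "\<dots> = (x [^] m) [^] u \<otimes> (x [^] n) [^] v"
    using assms(1) by (simp add: int_pow_mult int_pow_pow)
  finally show ?thesis using assms(2,3) by simp
qed

lemma power_of_coprime_power:
  assumes "x \<in> carrier G" "x [^] (n::int) = \<one>" "coprime m n"
  obtains u :: int where "(x [^] m) [^] u = x" "(x [^] u) [^] m = x"
proof -
  obtain u v where uv: "u * m + v * n = 1" using bezout_int[of m n] assms(3) by auto
  have "x = x [^] (m * u + n * v)" using uv assms(1) by (simp add: mult.commute)
  also have "\<dots> = x [^] (m * u) \<otimes> (x [^] n) [^] v"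
    using assms(1) by (simp add: int_pow_mult int_pow_pow)
  finally have "x [^] (m * u) = x" using assms(1,2) by simp
  then show thesis using that[of u] assms(1) by (simp add: int_pow_pow mult.commute)
qed

lemma torsionI: "x \<in> carrier G \<Longrightarrow> x [^] (n::int) = \<one> \<Longrightarrow> n \<noteq> 0 \<Longrightarrow> x \<in> torsion G"
  by (auto simp: torsion_def)

lemma torsion_chain_finite_top:
  assumes "torsion_chain G" and "finite F" "F \<noteq> {}" "F \<subseteq> torsion G"
  shows "\<exists>s\<in>F. \<forall>t\<in>F. has_power G s t"
  using assms(2-4)
proof (induction rule: finite_ne_induct)
  case (singleton x)
  then show ?case using has_power_refl torsion_carrier by auto
next
  case (insert x F)
  then obtain s where s: "s \<in> F" "\<forall>t\<in>F. has_power G s t" by auto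
  have carr: "x \<in> carrier G" "s \<in> carrier G" using insert s torsion_carrier by auto
  have "has_power G s x \<or> has_power G x s"
    using assms(1) insert.prems s(1) unfolding torsion_chain_def comparable_def by auto
  then show ?case
  proof
    assume "has_power G s x"
    then show ?thesis using s by auto
  next
    assume "has_power G x s"
    then have "\<forall>t\<in>insert x F. has_power G x t"
      using has_power_trans[OF carr(1)] has_power_refl[OF carr(1)] s(2) by blast
    then show ?thesis by blast
  qed
qed

text \<open>
  If there were more than \<open>n\<close> solutions, then \<open>n + 1\<close> of them would be
  powers of one of them, which has at most \<open>n\<close> powers.
\<close>
lemma torsion_chain_card_exponent_le:
  assumes "torsion_chain G" and n: "n > 0"
  shows "finite {t \<in> carrier G. t [^] int n = \<one>} \<and> card {t \<in> carrier G. t [^] int n = \<one>} \<le> n"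
    (is "finite ?S \<and> card ?S \<le> n")
proof (rule ccontr)
  assume contr: "\<not> ?thesis"
  have "\<exists>F\<subseteq>?S. finite F \<and> card F = Suc n"
  proof (cases "finite ?S")
    case True
    with contr have "Suc n \<le> card ?S" by auto
    then obtain F where "F \<subseteq> ?S" "card F = Suc n" "finite F" by (rule obtain_subset_with_card_n)
    then show ?thesis by blast
  next
    case False
    then show ?thesis using infinite_arbitrarily_large[of ?S "Suc n"] by blast
  qed
  then obtain F where F: "F \<subseteq> ?S" "finite F" "card F = Suc n" by blast
  have "F \<subseteq> torsion G" "F \<noteq> {}"
    using F n torsionI[of _ "int n"] by auto
  then obtain s where s: "s \<in> F" "\<forall>t\<in>F. has_power G s t"
    using torsion_chain_finite_top[OF assms(1) F(2)] by blast
  have sS: "s \<in> carrier G" "s [^] int n = \<one>" using s(1) F(1) by auto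
  have "F \<subseteq> (\<lambda>i. s [^] int i) ` {..<n}"
  proof
    fix t assume "t \<in> F"
    then obtain j :: int where j: "t = s [^] j" using s(2) by (auto simp: has_power_def)
    have "s [^] j = s [^] (int n * (j div int n) + j mod int n)" by simp
    also have "\<dots> = (s [^] int n) [^] (j div int n) \<otimes> s [^] (j mod int n)"
      using sS(1) by (simp only: int_pow_mult int_pow_pow)
    also have "\<dots> = s [^] int (nat (j mod int n))" using sS n by simp
    finally show "t \<in> (\<lambda>i. s [^] int i) ` {..<n}"
      using j n by (intro image_eqI[of _ _ "nat (j mod int n)"]) (auto simp: nat_less_iff)
  qed
  then have "card F \<le> n" using card_mono[of "(\<lambda>i. s [^] int i) ` {..<n}" F]
      card_image_le[of "{..<n}" "\<lambda>i. s [^] int i"] by simp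
  then show False using F(3) by simp
qed

lemma comparable_commutes:
  assumes "x \<in> carrier G" "y \<in> carrier G" "comparable G x y"
  shows "x \<otimes> y = y \<otimes> x"
proof -
  have pow_commutes: "a \<otimes> a [^] n = a [^] n \<otimes> a" if "a \<in> carrier G" for a and n :: int
    using int_pow_mult[OF that, of 1 n] int_pow_mult[OF that, of n 1] that by (simp add: add.commute)
  show ?thesis using assms pow_commutes by (auto simp: comparable_def has_power_def)
qed

lemma torsion_mult_closed:
  assumes "s \<in> torsion G" "t \<in> torsion G" "s \<otimes> t = t \<otimes> s"
  shows "s \<otimes> t \<in> torsion G"
proof -
  obtain i j :: int where ij: "i \<noteq> 0" "s [^] i = \<one>" "j \<noteq> 0" "t [^] j = \<one>"
    and carr: "s \<in> carrier G" "t \<in> carrier G"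
    using assms(1,2) by (auto simp: torsion_def)
  have "(s \<otimes> t) [^] (i * j) = (s [^] i) [^] j \<otimes> (t [^] j) [^] i"
    using carr by (simp add: int_pow_mult_distrib[OF assms(3)] int_pow_pow mult.commute)
  then have "(s \<otimes> t) [^] (i * j) = \<one>" using ij by simp
  then show ?thesis using ij carr torsionI[of "s \<otimes> t" "i * j"] by simp
qed

lemma prime_torsion_exists:
  assumes "torsion_chain G"
  obtains q s where "prime (q::nat)" "s \<in> carrier G" "s \<noteq> \<one>" "s [^] int q = \<one>"
proof -
  have "\<not> torsion G \<subseteq> {\<one>}"
    using assms finite_subset unfolding torsion_chain_def by blast
  then obtain t where t: "t \<in> torsion G" "t \<noteq> \<one>" by blast
  have tc: "t \<in> carrier G" using t torsion_carrier by blast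
  obtain n :: nat where n: "n > 0" "t [^] n = \<one>" using t(1) by (rule torsion_nat_pow)
  have "ord t \<noteq> 1" using ord_eq_1 tc t(2) by blast
  then obtain q where q: "prime q" "q dvd ord t" using prime_factor_nat by blast
  then obtain m where m: "ord t = q * m" by blast
  have "ord t dvd n" using n tc pow_eq_id by blast
  then have "m > 0" using m n by (cases m) auto
  have "\<not> ord t dvd m"
    using m \<open>m > 0\<close> prime_gt_1_nat[OF q(1)] by (auto dest: dvd_imp_le)
  then have "t [^] m \<noteq> \<one>" using tc pow_eq_id by blast
  moreover have "(t [^] m) [^] int q = \<one>"
    using tc m pow_ord_eq_1[OF tc] by (simp add: int_pow_int nat_pow_pow mult.commute)
  ultimately show thesis using that[of q "t [^] m"] q(1) tc by simp
qed

text \<open>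
  The part of \<open>t\<close> of order prime to \<open>q\<close> is comparable with the element
  \<open>s\<close> of order \<open>q\<close>, which is possible only if it is trivial.
\<close>
lemma torsion_chain_primary:
  assumes chain: "torsion_chain G" and q: "prime (q::nat)"
    and s: "s \<in> carrier G" "s \<noteq> \<one>" "s [^] int q = \<one>" and t: "t \<in> torsion G"
  shows "\<exists>k. t [^] (int q ^ k) = \<one>"
proof -
  have tc: "t \<in> carrier G" using t torsion_carrier by blast
  obtain n :: nat where n: "n > 0" "t [^] n = \<one>" using t by (rule torsion_nat_pow)
  obtain m where m: "n = q ^ multiplicity q n * m" "\<not> q dvd m"
    using multiplicity_decompose'[of n q] n(1) q by (metis not_prime_unit not_gr_zero)
  define k where "k = multiplicity q n"
  define u where "u = t [^] (int q ^ k)"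
  have uc: "u \<in> carrier G" using tc by (simp add: u_def)
  have "t [^] int n = \<one>" using n(2) by (simp add: int_pow_int)
  moreover have "int n = int q ^ k * int m" unfolding k_def by (subst m(1)) simp
  ultimately have um: "u [^] int m = \<one>"
    using tc by (simp add: u_def int_pow_pow)
  have cop: "coprime (int m) (int q)"
    using prime_imp_coprime[OF q m(2)] by (simp add: coprime_commute)
  have tors: "u \<in> torsion G" "s \<in> torsion G"
    using torsion_pow[OF t] torsionI[OF s(1) s(3)] prime_gt_0_nat[OF q] by (simp_all add: u_def)
  have "u = \<one>"
  proof (cases "has_power G u s")
    case True
    then obtain i :: int where i: "s = u [^] i" by (auto simp: has_power_def)
    have "s [^] int m = (u [^] int m) [^] i" using uc i by (simp add: int_pow_pow mult.commute)
    then have "s [^] int m = \<one>" using um by simp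
    then show ?thesis using eq_one_if_coprime_pows[OF s(1) _ s(3) cop] s(2) by simp
  next
    case False
    then obtain i :: int where i: "u = s [^] i"
      using chain tors unfolding torsion_chain_def comparable_def has_power_def by blast
    have "u [^] int q = (s [^] int q) [^] i" using s(1) i by (simp add: int_pow_pow mult.commute)
    then have "u [^] int q = \<one>" using s(3) by simp
    then show ?thesis using eq_one_if_coprime_pows[OF uc um _ cop] by simp
  qed
  then show ?thesis unfolding u_def by blast
qed

text \<open>
  Only roots of exponent \<open>q\<close> need an argument, since the order of \<open>x\<close> is
  some \<open>q\<^sup>k\<close>. There are only finitely many elements with exponent
  \<open>q\<^sup>k\<close>, so some \<open>r\<close> is not a power of \<open>x\<close>; then
  \<open>x\<close> is a power of \<open>r\<close>, and its exponent is a multiple of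
  \<open>q\<close>, as \<open>r\<close> would otherwise be a power of \<open>x\<close>.
\<close>
lemma torsion_chain_divisible:
  assumes chain: "torsion_chain G"
  shows "divisible_set G (torsion G)"
proof (rule divisible_setI_prime)
  show "torsion G \<subseteq> carrier G" using torsion_carrier by blast
  fix x and l :: int assume x: "x \<in> torsion G" and l: "prime l"
  have xc: "x \<in> carrier G" using x torsion_carrier by blast
  obtain q s where q: "prime (q::nat)" and s: "s \<in> carrier G" "s \<noteq> \<one>" "s [^] int q = \<one>"
    using chain by (rule prime_torsion_exists)
  note primary = torsion_chain_primary[OF chain q s]
  obtain k where k: "x [^] (int q ^ k) = \<one>" using primary[OF x] by blast
  show "\<exists>y\<in>torsion G. y [^] l = x"
  proof (cases "l = int q")
    case False
    then have "coprime l (int q ^ k)"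
      using primes_coprime[OF l, of "int q"] q by simp
    then obtain u :: int where "(x [^] u) [^] l = x"
      using power_of_coprime_power[OF xc k] by metis
    then show ?thesis using torsion_pow[OF x] by blast
  next
    case True
    have "q ^ k > 0" using prime_gt_0_nat[OF q] by simp
    then have "finite {t \<in> carrier G. t [^] int (q ^ k) = \<one>}"
      using torsion_chain_card_exponent_le[OF chain] by blast
    then have "\<not> torsion G \<subseteq> {t \<in> carrier G. t [^] int (q ^ k) = \<one>}"
      using chain finite_subset unfolding torsion_chain_def by blast
    then obtain r where r: "r \<in> torsion G" "r [^] (int q ^ k) \<noteq> \<one>"
      using torsion_carrier by auto
    have rc: "r \<in> carrier G" using r torsion_carrier by blast
    have not_pow: "r \<noteq> x [^] i" for i :: int
    proof
      assume "r = x [^] i"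
      then have "r [^] (int q ^ k) = (x [^] (int q ^ k)) [^] i"
        using xc by (simp add: int_pow_pow mult.commute)
      then show False using k r(2) by simp
    qed
    then obtain j :: int where j: "x = r [^] j"
      using chain r(1) x unfolding torsion_chain_def comparable_def has_power_def by blast
    obtain n where n: "r [^] (int q ^ n) = \<one>" using primary[OF r(1)] by blast
    have "int q dvd j"
    proof (rule ccontr)
      assume "\<not> int q dvd j"
      then have "coprime (int q) j" using q by (simp add: prime_imp_coprime)
      then have "coprime j (int q ^ n)" by (simp add: coprime_commute)
      then show False using power_of_coprime_power[OF rc n] j not_pow by metis
    qed
    then obtain i where "j = int q * i" by blast
    then have "(r [^] i) [^] l = x" using j rc True by (simp add: int_pow_pow mult.commute)
    then show ?thesis using torsion_pow[OF r(1)] by blast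
  qed
qed

end

section \<open>Commutativity from divisibility and finitely many roots\<close>

definition commensurable :: "('a, 'm) monoid_scheme \<Rightarrow> 'a \<Rightarrow> 'a \<Rightarrow> bool" where
  "commensurable K x y \<longleftrightarrow> (\<exists>(i::int) j::int. i \<noteq> 0 \<and> j \<noteq> 0 \<and> x [^]\<^bsub>K\<^esub> i = y [^]\<^bsub>K\<^esub> j)"

text \<open>
  An intrinsic characterisation, up to isomorphism, of the product of the rationals and the Pruefer
  \<open>q\<close>-group.
\<close>
definition rational_times_pruefer :: "nat \<Rightarrow> ('a, 'm) monoid_scheme \<Rightarrow> bool" where
  "rational_times_pruefer q K \<longleftrightarrow> comm_group K \<and> divisible_set K (carrier K) \<and>
     nontorsion K \<noteq> {} \<and> (\<forall>x\<in>nontorsion K. \<forall>y\<in>nontorsion K. commensurable K x y) \<and>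
     torsion_chain K \<and> prime q \<and> (\<exists>s\<in>carrier K. s \<noteq> \<one>\<^bsub>K\<^esub> \<and> s [^]\<^bsub>K\<^esub> int q = \<one>\<^bsub>K\<^esub>)"

context group
begin

lemma commensurable_sym: "commensurable G x y \<Longrightarrow> commensurable G y x"
  unfolding commensurable_def by metis

lemma commensurable_trans:
  assumes carr: "x \<in> carrier G" "y \<in> carrier G" "z \<in> carrier G"
    and xy: "commensurable G x y" and yz: "commensurable G y z"
  shows "commensurable G x z"
proof -
  obtain i j :: int where i: "i \<noteq> 0" "j \<noteq> 0" "x [^] i = y [^] j"
    using xy by (auto simp: commensurable_def)
  obtain k l :: int where k: "k \<noteq> 0" "l \<noteq> 0" "y [^] k = z [^] l"
    using yz by (auto simp: commensurable_def)
  have "x [^] (i * k) = (y [^] j) [^] k" using carr i by (simp flip: int_pow_pow)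
  also have "\<dots> = (y [^] k) [^] j" using carr by (simp add: int_pow_pow mult.commute)
  also have "\<dots> = z [^] (l * j)" using carr k by (simp add: int_pow_pow)
  finally show ?thesis using i k unfolding commensurable_def
    by (intro exI[of _ "i * k"] exI[of _ "l * j"]) simp
qed

lemma comparable_imp_commensurable:
  assumes "x \<in> carrier G" "y \<in> carrier G" "comparable G x y"
  shows "commensurable G x y"
proof -
  have "commensurable G a b" if "a \<in> carrier G" "b \<in> carrier G" "has_power G a b" for a b
  proof -
    obtain n :: int where "n \<noteq> 0" "b = a [^] n" using \<open>has_power G a b\<close> by (auto simp: has_power_def)
    then show ?thesis using that(2) unfolding commensurable_def
      by (intro exI[of _ n] exI[of _ "1::int"]) simp
  qed
  then show ?thesis using assms commensurable_sym unfolding comparable_def by blast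
qed

lemma comparable_one_iff_torsion: "x \<in> carrier G \<Longrightarrow> comparable G x \<one> \<longleftrightarrow> x \<in> torsion G"
  unfolding comparable_def has_power_def torsion_def
  by (auto intro: exI[of _ "1::int"])

lemma comparable_torsion_iff:
  assumes "x \<in> carrier G" "y \<in> carrier G" "comparable G x y"
  shows "x \<in> torsion G \<longleftrightarrow> y \<in> torsion G"
  using assms torsion_pow torsion_if_pow unfolding comparable_def has_power_def by blast

text \<open>
  With \<open>z\<^sup>3 = x\<^sup>2\<close>, the elements \<open>x\<close> and \<open>z\<close> are
  joined through \<open>x\<^sup>2\<close> but not adjacent.
\<close>
lemma nontorsion_not_universal_in_component:
  assumes div: "divisible_set G (carrier G)" and x: "x \<in> nontorsion G"
  obtains y z where "y \<in> carrier G" "z \<in> carrier G"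
    "comparable G x y" "comparable G y z" "\<not> comparable G x z"
proof -
  have xc: "x \<in> carrier G" using x nontorsion_carrier by blast
  obtain z where z: "z \<in> carrier G" "z [^] (3::int) = x [^] (2::int)"
    using div xc unfolding divisible_set_def by (meson int_pow_closed zero_less_numeral)
  have "comparable G x (x [^] (2::int))" by (simp add: comparable_def has_power_pow)
  moreover have "comparable G (x [^] (2::int)) z"
    using has_power_pow[of 3 z] z(2) by (simp add: comparable_def)
  moreover have x2: "x [^] (2::int) \<in> nontorsion G" using nontorsion_pow[OF x] by simp
  have "\<not> comparable G x z"
    using has_power_roots_imp_dvd[OF x2 refl z] has_power_roots_imp_dvd[OF x2 z(2) xc refl]
    unfolding comparable_def by auto
  ultimately show thesis using that[of "x [^] (2::int)" z] xc z(1) by simp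
qed

lemma finite_roots_if_finite_prime_roots:
  assumes prime_case: "\<And>a l. a \<in> nontorsion G \<Longrightarrow> prime (l::int) \<Longrightarrow> finite {z \<in> carrier G. z [^] l = a}"
    and "a \<in> nontorsion G" "n > 0"
  shows "finite {z \<in> carrier G. z [^] int n = a}"
  using assms(2,3)
proof (induction n arbitrary: a rule: less_induct)
  case (less n)
  show ?case
  proof (cases "n = 1")
    case True
    then have "{z \<in> carrier G. z [^] int n = a} \<subseteq> {a}" by auto
    then show ?thesis using finite_subset by blast
  next
    case False
    obtain l where l: "prime l" "l dvd n" using prime_factor_nat[OF False] by blast
    then obtain m where m: "n = l * m" by blast
    with l less have m0: "m > 0" "m < n" using prime_gt_1_nat[OF l(1)] by auto
    let ?B = "{b \<in> carrier G. b [^] int l = a}"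
    have "{z \<in> carrier G. z [^] int n = a} \<subseteq> (\<Union>b\<in>?B. {z \<in> carrier G. z [^] int m = b})"
      using m by (auto simp: int_pow_pow mult.commute)
    moreover have "finite {z \<in> carrier G. z [^] int m = b}" if "b \<in> ?B" for b
    proof -
      have "has_power G b a" using that prime_gt_0_nat[OF l(1)] has_power_pow[of "int l" b] by auto
      then have "b \<in> nontorsion G" using that less.prems(1) has_power_nontorsion_iff by blast
      then show ?thesis using less.IH m0 by blast
    qed
    moreover have "finite ?B" using prime_case less.prems(1) l(1) by simp
    ultimately show ?thesis using finite_subset by blast
  qed
qed

lemma conj_int_pow:
  assumes "d \<in> carrier G" "y \<in> carrier G"
  shows "(d \<otimes> y \<otimes> inv d) [^] (n::int) = d \<otimes> y [^] n \<otimes> inv d"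
proof -
  have nat: "(d \<otimes> y \<otimes> inv d) [^] k = d \<otimes> y [^] k \<otimes> inv d" for k :: nat
  proof (induction k)
    case 0
    then show ?case using assms by simp
  next
    case (Suc k)
    then show ?case using assms by (simp add: m_assoc inv_solve_left)
        (metis assms inv_closed l_inv l_one m_assoc m_closed nat_pow_closed)
  qed
  show ?thesis
  proof (cases n rule: int_cases2)
    case (nonneg k)
    then show ?thesis by (simp add: int_pow_int nat)
  next
    case (nonpos k)
    have yk: "y [^] k \<in> carrier G" using assms by simp
    have "inv (d \<otimes> y [^] k \<otimes> inv d) = d \<otimes> inv (y [^] k) \<otimes> inv d"
      using assms(1) yk by (simp add: inv_mult_group m_assoc)
    then show ?thesis using assms nonpos by (simp add: int_pow_neg_int nat)
  qed
qed

text \<open>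
  The divisible set \<open>A\<close> acts by conjugation on the finite set \<open>S\<close> of
  \<open>n\<close>-th roots of \<open>y\<^sup>n\<close>, because it commutes with
  \<open>y\<^sup>n\<close>. A divisible group acts trivially on a finite set: write \<open>d\<close>
  as the power of some \<open>b\<close> with exponent \<open>\<bar>S\<bar>!\<close>; by the
  pigeonhole principle some power of \<open>b\<close> with exponent between 1 and
  \<open>\<bar>S\<bar>\<close> fixes \<open>y\<close>, and \<open>d\<close> is a power of it.
\<close>
lemma spine_element_commutes:
  assumes A: "rational_spine G A" and d: "d \<in> A" and y: "y \<in> carrier G"
    and n: "n > 0" "y [^] int n \<in> A"
    and fin: "finite {z \<in> carrier G. z [^] int n = y [^] int n}"
  shows "d \<otimes> y = y \<otimes> d"
proof -
  define S where "S = {z \<in> carrier G. z [^] int n = y [^] int n}"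
  have Ac: "x \<in> carrier G" if "x \<in> A" for x
    using A that nontorsion_carrier by (auto simp: rational_spine_def)
  have comm: "u \<otimes> v = v \<otimes> u" if uv: "u \<in> A" "v \<in> A" for u v
  proof -
    obtain c where c: "c \<in> A" "has_power G c u" "has_power G c v"
      using A uv unfolding rational_spine_def by meson
    then obtain i j :: int where "u = c [^] i" "v = c [^] j" by (auto simp: has_power_def)
    then show ?thesis using Ac[OF c(1)] by (metis add.commute int_pow_mult)
  qed
  obtain b where b: "b \<in> A" "b [^] int (fact (card S)) = d"
    using A d unfolding rational_spine_def divisible_set_def by (meson fact_gt_zero of_nat_0_less_iff)
  have bc: "b \<in> carrier G" using Ac b by blast
  define conj where "conj i = b [^] int i \<otimes> y \<otimes> inv (b [^] int i)" for i :: nat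
  have "conj i \<in> S" for i
  proof -
    have "b [^] int i \<otimes> y [^] int n = y [^] int n \<otimes> b [^] int i"
    proof (cases "i = 0")
      case True
      then show ?thesis using y by simp
    next
      case False
      then have "b [^] int i \<in> A" using A b(1) by (simp add: rational_spine_def)
      then show ?thesis using comm n(2) by blast
    qed
    then have "conj i [^] int n = y [^] int n"
      using bc y unfolding conj_def
      by (subst conj_int_pow) (simp_all add: m_assoc)
    then show ?thesis using bc y by (simp add: S_def conj_def)
  qed
  then have "conj ` {..card S} \<subseteq> S" by blast
  then have "card (conj ` {..card S}) \<le> card S"
    using fin by (intro card_mono) (simp_all add: S_def)
  then have "\<not> inj_on conj {..card S}"
    using card_image[of conj "{..card S}"] by auto
  \<comment> \<open>There are \<open>card S + 1\<close> exponents for \<open>card S\<close> values.\<close>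
  then obtain i j where ij: "i < j" "j \<le> card S" "conj i = conj j"
    unfolding inj_on_def by (metis atMost_iff linorder_neqE_nat)
  define e where "e = b [^] int (j - i)"
  have ec: "e \<in> carrier G" using bc by (simp add: e_def)
  have "b [^] int j = b [^] int i \<otimes> e"
    using ij(1) bc by (simp add: e_def of_nat_diff flip: int_pow_mult)
  then have "b [^] int i \<otimes> y \<otimes> inv (b [^] int i) = b [^] int i \<otimes> (e \<otimes> y \<otimes> inv e) \<otimes> inv (b [^] int i)"
    using ij(3) bc y ec by (simp add: conj_def inv_mult_group m_assoc)
  then have "y = e \<otimes> y \<otimes> inv e" using bc y ec by simp
  then have ey: "e \<otimes> y = y \<otimes> e" using y ec by (metis inv_solve_right m_closed)
  have "j - i dvd fact (card S)" using ij by (intro dvd_fact) auto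
  then obtain k where k: "fact (card S) = (j - i) * k" by blast
  have "d = e [^] int k" using b(2) bc k by (simp add: e_def int_pow_pow flip: of_nat_mult)
  moreover have "e [^] m \<otimes> y = y \<otimes> e [^] m" for m :: nat
    using ey ec y by (induction m) (simp_all add: m_assoc, metis m_assoc nat_pow_closed)
  ultimately show ?thesis by (simp add: int_pow_int)
qed

text \<open>
  Commensurability and divisibility give \<open>d\<close> in \<open>A\<close> having a common
  nontrivial power \<open>y\<^sup>i = d\<^sup>i\<close> with \<open>y\<close>; as \<open>d\<close>
  is central, the quotient is torsion.
\<close>
lemma rational_spine_splits:
  assumes A: "rational_spine G A" and central: "\<And>d y. d \<in> A \<Longrightarrow> y \<in> carrier G \<Longrightarrow> d \<otimes> y = y \<otimes> d"
    and comm: "\<And>x y. x \<in> nontorsion G \<Longrightarrow> y \<in> nontorsion G \<Longrightarrow> commensurable G x y"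
    and y: "y \<in> nontorsion G"
  obtains d t where "d \<in> A" "t \<in> torsion G" "y = d \<otimes> t"
proof -
  obtain a where a: "a \<in> A" "a \<in> nontorsion G" using A by (auto simp: rational_spine_def)
  obtain i j :: int where ij: "i \<noteq> 0" "j \<noteq> 0" "y [^] i = a [^] j"
    using comm[OF y a(2)] by (auto simp: commensurable_def)
  have yc: "y \<in> carrier G" using y nontorsion_carrier by blast
  obtain c where c: "c \<in> A" "c [^] \<bar>i\<bar> = a"
    using A a(1) ij(1) unfolding rational_spine_def divisible_set_def by (metis zero_less_abs_iff)
  have cc: "c \<in> carrier G" using A c nontorsion_carrier by (auto simp: rational_spine_def)
  define d where "d = c [^] (sgn i * j)"
  have d: "d \<in> A" "d \<in> carrier G"
    using A c(1) cc ij by (auto simp: d_def rational_spine_def sgn_0_0)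
  have di: "d [^] i = y [^] i"
    using ij(3) c(2) cc by (simp add: d_def int_pow_pow abs_sgn ac_simps flip: c(2))
  have "inv d \<otimes> y = y \<otimes> inv d"
    using central[OF d(1) yc] d(2) yc by (metis inv_closed inv_solve_left inv_solve_right m_assoc m_closed)
  then have "(inv d \<otimes> y) [^] i = inv d [^] i \<otimes> y [^] i"
    using d(2) yc by (intro int_pow_mult_distrib) auto
  then have "(inv d \<otimes> y) [^] i = \<one>"
    using d(2) yc di by (simp add: int_pow_inv)
  then have "inv d \<otimes> y \<in> torsion G" using d(2) yc ij(1) by (intro torsionI) auto
  moreover have "y = d \<otimes> (inv d \<otimes> y)" using d(2) yc by (simp flip: m_assoc)
  ultimately show thesis using that d(1) by blast
qed

text \<open>
  Comparable torsion elements commute and have a torsion product, so the torsion elements form a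
  subgroup.
\<close>
lemma torsion_times_nontorsion:
  assumes chain: "torsion_chain G" and t: "t \<in> torsion G" and x: "x \<in> nontorsion G"
  shows "t \<otimes> x \<in> nontorsion G"
proof (rule ccontr)
  assume "t \<otimes> x \<notin> nontorsion G"
  have tc: "t \<in> carrier G" and xc: "x \<in> carrier G"
    using t x torsion_carrier nontorsion_carrier by blast+
  have tx: "t \<otimes> x \<in> torsion G"
    using \<open>t \<otimes> x \<notin> nontorsion G\<close> tc xc by (simp add: nontorsion_def)
  have it: "inv t \<in> torsion G" using torsion_pow[OF t, of "-1"] tc by (simp add: int_pow_neg)
  have "comparable G (inv t) (t \<otimes> x)" using chain it tx by (simp add: torsion_chain_def)
  then have "inv t \<otimes> (t \<otimes> x) \<in> torsion G"
    using comparable_commutes torsion_mult_closed it tx torsion_carrier by blast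
  then have "x \<in> torsion G" using tc xc by (simp flip: m_assoc)
  then show False using x by (simp add: nontorsion_def)
qed

text \<open>
  Torsion elements \<open>t\<close> also commute with \<open>d\<close> in \<open>A\<close>, because
  \<open>t d\<close> has infinite order. So \<open>A\<close> is central, and every element is the
  product of a torsion element and an element that is trivial or in \<open>A\<close>.
\<close>
lemma comm_divisible_if_spine_and_finite_roots:
  assumes A: "rational_spine G A" and chain: "torsion_chain G"
    and comm: "\<And>x y. x \<in> nontorsion G \<Longrightarrow> y \<in> nontorsion G \<Longrightarrow> commensurable G x y"
    and fin: "\<And>a n. a \<in> nontorsion G \<Longrightarrow> n > 0 \<Longrightarrow> finite {z \<in> carrier G. z [^] int n = a}"
  shows "comm_group G \<and> divisible_set G (carrier G)"
proof
  have An: "x \<in> nontorsion G" if "x \<in> A" for x using A that by (auto simp: rational_spine_def)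
  have An': "x \<in> carrier G" if "x \<in> A" for x using An[OF that] nontorsion_carrier by blast
  have central_nt: "d \<otimes> y = y \<otimes> d" if d: "d \<in> A" and y: "y \<in> nontorsion G" for d y
  proof -
    obtain a where a: "a \<in> A" using d by blast
    obtain i j :: int where ij: "i \<noteq> 0" "j \<noteq> 0" "y [^] i = a [^] j"
      using comm[OF y An[OF a]] by (auto simp: commensurable_def)
    have yc: "y \<in> carrier G" using y nontorsion_carrier by blast
    have "y [^] \<bar>i\<bar> = a [^] (sgn i * j)"
      using ij(3) yc An'[OF a] by (metis abs_sgn int_pow_pow mult.commute)
    moreover have "a [^] (sgn i * j) \<in> A" using A a ij by (simp add: rational_spine_def sgn_0_0)
    ultimately have "y [^] int (nat \<bar>i\<bar>) \<in> A" by simp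
    moreover have "nat \<bar>i\<bar> > 0" using ij(1) by simp
    ultimately show ?thesis
      using spine_element_commutes[OF A d yc, of "nat \<bar>i\<bar>"] fin An by blast
  qed
  have central: "d \<otimes> y = y \<otimes> d" if d: "d \<in> A" and y: "y \<in> carrier G" for d y
  proof (cases "y \<in> torsion G")
    case False
    then show ?thesis using central_nt[OF d] y by (simp add: nontorsion_def)
  next
    case True
    have "d \<otimes> (y \<otimes> d) = (y \<otimes> d) \<otimes> d"
      using central_nt[OF d torsion_times_nontorsion[OF chain True An[OF d]]] .
    then show ?thesis using An'[OF d] y by (simp flip: m_assoc)
  qed
  have split: "\<exists>d t. (d = \<one> \<or> d \<in> A) \<and> t \<in> torsion G \<and> y = d \<otimes> t" if "y \<in> carrier G" for y
  proof (cases "y \<in> torsion G")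
    case True
    then show ?thesis using that by (intro exI[of _ \<one>] exI[of _ y]) simp
  next
    case False
    then have "y \<in> nontorsion G" using that by (simp add: nontorsion_def)
    then obtain d t where "d \<in> A" "t \<in> torsion G" "y = d \<otimes> t"
      using rational_spine_splits[OF A central comm] by blast
    then show ?thesis by blast
  qed
  show "comm_group G"
  proof (rule group_comm_groupI)
    fix x y assume x: "x \<in> carrier G" and y: "y \<in> carrier G"
    obtain c s where c: "c = \<one> \<or> c \<in> A" "s \<in> torsion G" "x = c \<otimes> s" using split[OF x] by blast
    obtain d t where d: "d = \<one> \<or> d \<in> A" "t \<in> torsion G" "y = d \<otimes> t" using split[OF y] by blast
    have sc: "s \<in> carrier G" "t \<in> carrier G" "c \<in> carrier G" "d \<in> carrier G"
      using c d torsion_carrier An' by auto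
    have st: "s \<otimes> t = t \<otimes> s"
      using comparable_commutes chain c(2) d(2) sc unfolding torsion_chain_def by blast
    have cy: "c \<otimes> z = z \<otimes> c" if "z \<in> carrier G" for z using c(1) central[of c z] that by auto
    have dy: "d \<otimes> z = z \<otimes> d" if "z \<in> carrier G" for z using d(1) central[of d z] that by auto
    have "x \<otimes> y = c \<otimes> (s \<otimes> (d \<otimes> t))" using sc c(3) d(3) by (simp add: m_assoc)
    also have "s \<otimes> (d \<otimes> t) = (d \<otimes> t) \<otimes> s"
      using sc st dy[of s] by (metis m_assoc)
    also have "c \<otimes> ((d \<otimes> t) \<otimes> s) = y \<otimes> x"
      using sc cy[of "d \<otimes> t"] c(3) d(3) by (metis m_assoc m_closed)
    finally show "x \<otimes> y = y \<otimes> x" .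
  qed
  show "divisible_set G (carrier G)"
    unfolding divisible_set_def
  proof (intro ballI allI impI)
    fix y and n :: int assume y: "y \<in> carrier G" and n: "n > 0"
    obtain d t where d: "d = \<one> \<or> d \<in> A" "t \<in> torsion G" "y = d \<otimes> t" using split[OF y] by blast
    obtain s where s: "s \<in> torsion G" "s [^] n = t"
      using torsion_chain_divisible[OF chain] d(2) n unfolding divisible_set_def by blast
    obtain c where c: "c = \<one> \<or> c \<in> A" "c [^] n = d"
      using A d(1) n unfolding rational_spine_def divisible_set_def by (metis int_pow_one)
    have cc: "c \<in> carrier G" "s \<in> carrier G" using c s torsion_carrier An' by auto
    have "c \<otimes> s = s \<otimes> c" using c(1) central[of c s] cc by auto
    then have "(c \<otimes> s) [^] n = y" using int_pow_mult_distrib cc c s d by simp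
    then show "\<exists>z\<in>carrier G. z [^] n = y" using cc by blast
  qed
qed

end

section \<open>Transfer along an isomorphism of power graphs\<close>

lemma (in group) comparable_iff_adjacent:
  "x \<in> carrier G \<Longrightarrow> y \<in> carrier G \<Longrightarrow>
     comparable G x y \<longleftrightarrow> x = y \<or> {x, y} \<in> edges (power_graph G)"
  using has_power_refl unfolding power_graph_adjacent_iff comparable_def has_power_def by blast

lemma graph_isomorphic_power_graphs_obtain:
  assumes iso: "graph_isomorphic (power_graph K) (power_graph G)" and "group K" "group G"
  obtains f where "bij_betw f (carrier K) (carrier G)"
    "\<forall>x\<in>carrier K. \<forall>y\<in>carrier K. comparable G (f x) (f y) \<longleftrightarrow> comparable K x y"
proof -
  obtain f where bij: "bij_betw f (carrier K) (carrier G)"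
    and adj: "\<And>x y. x \<in> carrier K \<Longrightarrow> y \<in> carrier K \<Longrightarrow>
      {x, y} \<in> edges (power_graph K) \<longleftrightarrow> {f x, f y} \<in> edges (power_graph G)"
    using iso unfolding graph_isomorphic_def by (auto simp: power_graph_def)
  show thesis
  proof (rule that[OF bij], intro ballI)
    fix x y assume xy: "x \<in> carrier K" "y \<in> carrier K"
    then have "f x \<in> carrier G" "f y \<in> carrier G" "f x = f y \<longleftrightarrow> x = y"
      using bij by (auto simp: bij_betw_def inj_on_eq_iff)
    then show "comparable G (f x) (f y) \<longleftrightarrow> comparable K x y"
      using adj[OF xy] xy group.comparable_iff_adjacent assms(2,3) by metis
  qed
qed

text \<open>
  In \<open>G\<close>, torsion means comparable with the identity, and in \<open>K\<close> torsion
  elements are comparable with each other; so it suffices that the preimage \<open>u\<close> of the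
  identity is torsion. If \<open>u\<close> had infinite order, all of its connected component would
  consist of elements comparable with \<open>u\<close>.
\<close>
lemma comparability_iso_torsion_iff:
  assumes "group K" "group G" and div: "divisible_set K (carrier K)" and chain: "torsion_chain K"
    and bij: "bij_betw f (carrier K) (carrier G)"
    and cmp: "\<And>x y. x \<in> carrier K \<Longrightarrow> y \<in> carrier K \<Longrightarrow> comparable G (f x) (f y) \<longleftrightarrow> comparable K x y"
    and x: "x \<in> carrier K"
  shows "f x \<in> torsion G \<longleftrightarrow> x \<in> torsion K"
proof -
  interpret K: group K by fact
  interpret G: group G by fact
  have fc: "f y \<in> carrier G" if "y \<in> carrier K" for y using bij that by (rule bij_betwE[THEN bspec])
  obtain u where u: "u \<in> carrier K" "f u = \<one>\<^bsub>G\<^esub>"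
    using bij by (metis G.one_closed bij_betw_imp_surj_on imageE)
  have "u \<in> torsion K"
  proof (rule ccontr)
    assume "u \<notin> torsion K"
    then have "u \<in> nontorsion K" using u(1) by (simp add: nontorsion_def)
    then obtain y z where yz: "y \<in> carrier K" "z \<in> carrier K"
      "comparable K u y" "comparable K y z" "\<not> comparable K u z"
      using K.nontorsion_not_universal_in_component[OF div] by blast
    have "f y \<in> torsion G"
      using cmp[OF u(1) yz(1)] yz(3) u(2) G.comparable_one_iff_torsion[OF fc[OF yz(1)]] comparable_commute[of G] by metis
    then have "f z \<in> torsion G"
      using G.comparable_torsion_iff[OF fc[OF yz(1)] fc[OF yz(2)]] cmp[OF yz(1,2)] yz(4) by blast
    then have "comparable K u z"
      using cmp[OF u(1) yz(2)] u(2) G.comparable_one_iff_torsion[OF fc[OF yz(2)]] comparable_commute[of G] by metis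
    then show False using yz(5) by blast
  qed
  then have "x \<in> torsion K \<longleftrightarrow> comparable K x u"
    using chain K.comparable_torsion_iff[OF x u(1)] unfolding torsion_chain_def by blast
  also have "\<dots> \<longleftrightarrow> f x \<in> torsion G"
    using cmp[OF x u(1)] u(2) G.comparable_one_iff_torsion[OF fc[OF x]] by simp
  finally show ?thesis by blast
qed

text \<open>
  Two \<open>p\<close>-th roots of \<open>x\<close> that differ by an element of order
  \<open>p\<close>.
\<close>
lemma rational_times_pruefer_roots_without_common_root:
  assumes K: "rational_times_pruefer p K" and x: "x \<in> nontorsion K"
  shows "\<exists>y\<in>carrier K. \<exists>z\<in>carrier K.
    strict_power K y x \<and> strict_power K z x \<and> \<not> common_root K y z"
proof -
  interpret K: comm_group K using K by (simp add: rational_times_pruefer_def)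
  obtain s where p: "prime p" and s: "s \<in> carrier K" "s \<noteq> \<one>\<^bsub>K\<^esub>" "s [^]\<^bsub>K\<^esub> int p = \<one>\<^bsub>K\<^esub>"
    using K by (auto simp: rational_times_pruefer_def)
  have p2: "int p \<ge> 2" using prime_ge_2_nat[OF p] by simp
  have xc: "x \<in> carrier K" using x K.nontorsion_carrier by blast
  obtain y where y: "y \<in> carrier K" "y [^]\<^bsub>K\<^esub> int p = x"
  proof -
    have "int p > 0" using p2 by simp
    then show thesis
      using that K xc unfolding rational_times_pruefer_def divisible_set_def by meson
  qed
  define z where "z = y \<otimes>\<^bsub>K\<^esub> s"
  have z: "z \<in> carrier K" "z [^]\<^bsub>K\<^esub> int p = x"
    using y s by (simp_all add: z_def K.int_pow_distrib xc)
  have strict: "strict_power K w x" if "w \<in> carrier K" "w [^]\<^bsub>K\<^esub> int p = x" for w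
  proof -
    have "has_power K w x" using K.has_power_pow[of "int p" w] that p2 by simp
    then have "w \<in> nontorsion K" using K.has_power_nontorsion_iff that x by blast
    then show ?thesis using K.strict_power_powI[of w "int p"] that p2 by simp
  qed
  have "y \<noteq> z" using y(1) s(1,2) by (simp add: z_def)
  then have "\<not> common_root K y z"
    using K.equal_if_common_root[of y "int p" z] x y z by auto
  then show ?thesis using strict y z by blast
qed

text \<open>
  The \<open>p\<close>-th power of an element of infinite order of \<open>K\<close> has at least
  \<open>p\<close> roots of exponent \<open>p\<close>. They inject into the elements of
  \<open>L\<close> killed by some prime, which must be \<open>q\<close>, and there are at most
  \<open>q\<close> of those.
\<close>
lemma rational_times_pruefer_prime_le:
  assumes K: "rational_times_pruefer p K" and L: "rational_times_pruefer q L"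
    and f: "power_digraph_iso K L f"
  shows "p \<le> q"
proof -
  interpret K: comm_group K using K by (simp add: rational_times_pruefer_def)
  interpret L: comm_group L using L by (simp add: rational_times_pruefer_def)
  obtain s where p: "prime p" and s: "s \<in> carrier K" "s \<noteq> \<one>\<^bsub>K\<^esub>" "s [^]\<^bsub>K\<^esub> int p = \<one>\<^bsub>K\<^esub>"
    using K by (auto simp: rational_times_pruefer_def)
  obtain t where q: "prime q" and t: "t \<in> carrier L" "t \<noteq> \<one>\<^bsub>L\<^esub>" "t [^]\<^bsub>L\<^esub> int q = \<one>\<^bsub>L\<^esub>"
    using L by (auto simp: rational_times_pruefer_def)
  obtain a where a: "a \<in> nontorsion K" using K by (auto simp: rational_times_pruefer_def)
  have ac: "a \<in> carrier K" using a K.nontorsion_carrier by blast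
  define S where "S = {z \<in> carrier K. z [^]\<^bsub>K\<^esub> int p = a [^]\<^bsub>K\<^esub> int p}"
  have "a [^]\<^bsub>K\<^esub> int p \<in> nontorsion K" using K.nontorsion_pow[OF a] prime_gt_0_nat[OF p] by simp
  then obtain r :: int and h where r: "prime r" and h: "inj_on h S"
      "h ` S \<subseteq> {t \<in> carrier L. t [^]\<^bsub>L\<^esub> r = \<one>\<^bsub>L\<^esub>}"
    using prime_roots_inject_into_torsion[OF K.is_group L.comm_group_axioms f, of "a [^]\<^bsub>K\<^esub> int p" "int p"] p
    unfolding S_def by auto
  define g where "g i = a \<otimes>\<^bsub>K\<^esub> s [^]\<^bsub>K\<^esub> int i" for i
  have "g i \<in> S" for i
  proof -
    have "(s [^]\<^bsub>K\<^esub> int i) [^]\<^bsub>K\<^esub> int p = (s [^]\<^bsub>K\<^esub> int p) [^]\<^bsub>K\<^esub> int i"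
      using s(1) by (simp only: K.int_pow_pow mult.commute)
    then show ?thesis using ac s by (simp add: g_def S_def K.int_pow_distrib)
  qed
  moreover have "inj_on g {..<p}"
  proof (rule linorder_inj_onI)
    fix i j assume ij: "i < j" "i \<in> {..<p}" "j \<in> {..<p}"
    show "g i \<noteq> g j"
    proof
      assume "g i = g j"
      then have "s [^]\<^bsub>K\<^esub> int j = s [^]\<^bsub>K\<^esub> int i" using ac s(1) by (simp add: g_def)
      then have "s [^]\<^bsub>K\<^esub> (int j - int i) = \<one>\<^bsub>K\<^esub>" using s(1) by (simp add: K.int_pow_diff)
      moreover have "coprime (int j - int i) (int p)"
      proof -
        have "\<not> int p dvd int j - int i" using ij by (auto dest: zdvd_imp_le)
        then have "coprime (int p) (int j - int i)" using p by (simp add: prime_imp_coprime)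
        then show ?thesis by (simp add: coprime_commute)
      qed
      ultimately show False using K.eq_one_if_coprime_pows s by blast
    qed
  qed auto
  ultimately have inj: "inj_on (h \<circ> g) {..<p}"
    using h(1) by (intro comp_inj_on) (auto intro: inj_on_subset)
  define R where "R = {t \<in> carrier L. t [^]\<^bsub>L\<^esub> int (nat r) = \<one>\<^bsub>L\<^esub>}"
  have r0: "int (nat r) = r" "nat r > 0" using prime_gt_0_int[OF r] by auto
  have chain: "torsion_chain L" using L by (simp add: rational_times_pruefer_def)
  have R: "finite R" "card R \<le> nat r"
    using L.torsion_chain_card_exponent_le[OF chain r0(2)] by (simp_all add: R_def)
  have "(h \<circ> g) ` {..<p} \<subseteq> R" using h(2) \<open>\<And>i. g i \<in> S\<close> r0(1) by (auto simp: R_def)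
  then have pR: "p \<le> card R" using card_inj_on_le[OF inj _ R(1)] by simp
  \<comment> \<open>A nontrivial element of \<open>R\<close> has order \<open>r\<close>, while all orders in the torsion part are powers of \<open>q\<close>.\<close>
  have "\<not> R \<subseteq> {\<one>\<^bsub>L\<^esub>}"
    using pR prime_ge_2_nat[OF p] card_mono[of "{\<one>\<^bsub>L\<^esub>}" R] by auto
  then obtain v where v: "v \<in> carrier L" "v [^]\<^bsub>L\<^esub> r = \<one>\<^bsub>L\<^esub>" "v \<noteq> \<one>\<^bsub>L\<^esub>"
    using r0(1) by (auto simp: R_def)
  have "v \<in> torsion L" using L.torsionI[OF v(1,2)] r by auto
  then obtain k where k: "v [^]\<^bsub>L\<^esub> (int q ^ k) = \<one>\<^bsub>L\<^esub>"
    using L.torsion_chain_primary[OF chain q t] by blast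
  have "r = int q"
  proof (rule ccontr)
    assume "r \<noteq> int q"
    then have "coprime r (int q ^ k)" using primes_coprime[OF r, of "int q"] q by simp
    then show False using L.eq_one_if_coprime_pows[OF v(1,2) k] v(3) by blast
  qed
  then show ?thesis using pR R(2) by simp
qed

lemma power_graph_iso_preserves_structure:
  assumes K: "rational_times_pruefer p K" and G: "group G"
    and iso: "graph_isomorphic (power_graph K) (power_graph G)"
  shows "rational_times_pruefer p G"
proof -
  interpret K: comm_group K using K by (simp add: rational_times_pruefer_def)
  interpret G: group G by fact
  have div: "divisible_set K (carrier K)" and chainK: "torsion_chain K"
    and commK: "\<And>x y. x \<in> nontorsion K \<Longrightarrow> y \<in> nontorsion K \<Longrightarrow> commensurable K x y"
    using K by (auto simp: rational_times_pruefer_def)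
  obtain f where bij: "bij_betw f (carrier K) (carrier G)"
    and cmp_all: "\<forall>x\<in>carrier K. \<forall>y\<in>carrier K. comparable G (f x) (f y) \<longleftrightarrow> comparable K x y"
    by (rule graph_isomorphic_power_graphs_obtain[OF iso K.is_group G])
  have cmp: "comparable G (f x) (f y) \<longleftrightarrow> comparable K x y" if "x \<in> carrier K" "y \<in> carrier K" for x y
    using cmp_all that by blast
  have tors: "f x \<in> torsion G \<longleftrightarrow> x \<in> torsion K" if "x \<in> carrier K" for x
    using comparability_iso_torsion_iff[OF K.is_group G div chainK bij cmp that] .
  have img: "f ` carrier K = carrier G" and inj: "inj_on f (carrier K)"
    using bij by (auto simp: bij_betw_def)
  have imgT: "f ` torsion K = torsion G"
  proof (intro equalityI subsetI)
    fix u assume "u \<in> f ` torsion K"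
    then show "u \<in> torsion G" using tors K.torsion_carrier by blast
  next
    fix u assume u: "u \<in> torsion G"
    then obtain x where "x \<in> carrier K" "u = f x" using img G.torsion_carrier by blast
    then show "u \<in> f ` torsion K" using tors u by blast
  qed
  have chainG: "torsion_chain G"
    unfolding torsion_chain_def
  proof (intro conjI ballI)
    show "infinite (torsion G)"
    proof -
      have "inj_on f (torsion K)" using inj K.torsion_carrier by (blast intro: inj_on_subset)
      then show ?thesis using chainK imgT finite_image_iff unfolding torsion_chain_def by metis
    qed
    fix u v assume "u \<in> torsion G" "v \<in> torsion G"
    then obtain x y where "x \<in> torsion K" "y \<in> torsion K" "u = f x" "v = f y" using imgT by blast
    then show "comparable G u v"
      using cmp chainK K.torsion_carrier unfolding torsion_chain_def by metis
  qed
  have imgN: "f ` nontorsion K = nontorsion G"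
  proof -
    have "torsion K \<subseteq> carrier K" using K.torsion_carrier by blast
    then show ?thesis
      unfolding nontorsion_def using inj_on_image_set_diff[OF inj, of "carrier K" "torsion K"] img imgT by auto
  qed
  then have bijN: "bij_betw f (nontorsion K) (nontorsion G)"
    using inj_on_subset[OF inj, of "nontorsion K"] K.nontorsion_carrier unfolding bij_betw_def by blast
  have f: "power_digraph_iso K G f"
    using comparability_iso_preserves_direction[OF K.is_group G div rational_times_pruefer_roots_without_common_root[OF K] bijN]
      cmp K.nontorsion_carrier by blast
  have commG: "commensurable G u v" if uv: "u \<in> nontorsion G" "v \<in> nontorsion G" for u v
  proof -
    obtain x y where x: "x \<in> nontorsion K" "u = f x" and y: "y \<in> nontorsion K" "v = f y"
      using uv imgN by blast
    obtain i j :: int where ij: "i \<noteq> 0" "j \<noteq> 0" "x [^]\<^bsub>K\<^esub> i = y [^]\<^bsub>K\<^esub> j"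
      using commK[OF x(1) y(1)] by (auto simp: commensurable_def)
    define w where "w = f (x [^]\<^bsub>K\<^esub> i)"
    have wN: "x [^]\<^bsub>K\<^esub> i \<in> nontorsion K" using K.nontorsion_pow x(1) ij(1) by blast
    then have wc: "w \<in> carrier G" using imgN G.nontorsion_carrier by (auto simp: w_def)
    have "has_power G u w"
      using power_digraph_iso_has_power[OF f x(1) wN] K.has_power_pow[OF ij(1)] x(2) by (simp add: w_def)
    moreover have "has_power G v w"
      using power_digraph_iso_has_power[OF f y(1) wN] K.has_power_pow[OF ij(2), of y] y(2) ij(3) by (simp add: w_def)
    ultimately have "commensurable G u w" "commensurable G w v"
      using G.comparable_imp_commensurable wc uv G.nontorsion_carrier unfolding comparable_def by blast+
    then show ?thesis using G.commensurable_trans wc uv G.nontorsion_carrier by blast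
  qed
  obtain x where x: "x \<in> nontorsion K" using K by (auto simp: rational_times_pruefer_def)
  obtain s :: "nat \<Rightarrow> 'a" where "rational_spine K {y. \<exists>k. has_power K (s k) y}"
    by (rule K.rational_spine_exists[OF div x])
  then have spine: "rational_spine G (f ` {y. \<exists>k. has_power K (s k) y})"
    using power_digraph_iso_rational_spine[OF K.is_group G f] by blast
  note g = power_digraph_iso_inverse[OF f]
  have "finite {z \<in> carrier G. z [^]\<^bsub>G\<^esub> l = a}" if a: "a \<in> nontorsion G" and l: "prime (l::int)" for a l
  proof -
    obtain r :: int and h where r: "prime r" and h: "inj_on h {z \<in> carrier G. z [^]\<^bsub>G\<^esub> l = a}"
      "h ` {z \<in> carrier G. z [^]\<^bsub>G\<^esub> l = a} \<subseteq> {t \<in> carrier K. t [^]\<^bsub>K\<^esub> r = \<one>\<^bsub>K\<^esub>}"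
      using prime_roots_inject_into_torsion[OF G K.comm_group_axioms g a l] by blast
    have "int (nat r) = r" "nat r > 0" using prime_gt_0_int[OF r] by auto
    then have "finite {t \<in> carrier K. t [^]\<^bsub>K\<^esub> r = \<one>\<^bsub>K\<^esub>}"
      using K.torsion_chain_card_exponent_le[OF chainK, of "nat r"] by simp
    then show ?thesis using h by (meson finite_imageD finite_subset)
  qed
  then have "comm_group G \<and> divisible_set G (carrier G)"
    using G.comm_divisible_if_spine_and_finite_roots[OF spine chainG commG] G.finite_roots_if_finite_prime_roots by blast
  moreover obtain q t where q: "prime (q::nat)" and t: "t \<in> carrier G" "t \<noteq> \<one>\<^bsub>G\<^esub>" "t [^]\<^bsub>G\<^esub> int q = \<one>\<^bsub>G\<^esub>"
    using chainG by (rule G.prime_torsion_exists)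
  moreover have "nontorsion G \<noteq> {}" using x imgN by blast
  ultimately have G': "rational_times_pruefer q G"
    using commG chainG unfolding rational_times_pruefer_def by blast
  have "p = q"
    using rational_times_pruefer_prime_le[OF K G' f] rational_times_pruefer_prime_le[OF G' K g] by simp
  then show ?thesis using G' by simp
qed

section \<open>Uniqueness of the structure\<close>

text \<open>
  Two chains of roots: \<open>a k\<close> plays the role of \<open>1 / k!\<close> in the rationals,
  and \<open>t k\<close> that of a generator of the subgroup of order \<open>p\<close> to the power
  \<open>k + 1\<close> in the Pruefer group. The exponents linking consecutive members are fixed, so
  that the chains of two groups can be matched term by term.
\<close>
definition resolution ::
    "nat \<Rightarrow> ('a, 'm) monoid_scheme \<Rightarrow> (nat \<Rightarrow> 'a) \<Rightarrow> (nat \<Rightarrow> 'a) \<Rightarrow> bool" where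
  "resolution p K a t \<longleftrightarrow>
     (\<forall>k. a k \<in> nontorsion K \<and> a (Suc k) [^]\<^bsub>K\<^esub> int (Suc k) = a k) \<and>
     (\<forall>k. t k \<in> carrier K \<and> t (Suc k) [^]\<^bsub>K\<^esub> int p = t k \<and>
          (\<forall>j::int. t k [^]\<^bsub>K\<^esub> j = \<one>\<^bsub>K\<^esub> \<longleftrightarrow> int p ^ Suc k dvd j)) \<and>
     (\<forall>y\<in>carrier K. \<exists>k (i::int) (j::int). y = a k [^]\<^bsub>K\<^esub> i \<otimes>\<^bsub>K\<^esub> t k [^]\<^bsub>K\<^esub> j)"

lemma (in group) int_pow_prime_eq_one_iff:
  assumes "s \<in> carrier G" "s \<noteq> \<one>" "s [^] int p = \<one>" "prime p"
  shows "s [^] (j::int) = \<one> \<longleftrightarrow> int p dvd j"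
proof
  assume j: "s [^] j = \<one>"
  show "int p dvd j"
  proof (rule ccontr)
    assume "\<not> int p dvd j"
    then have "coprime (int p) j" using assms(4) by (simp add: prime_imp_coprime)
    then show False using eq_one_if_coprime_pows[OF assms(1,3) j] assms(2) by blast
  qed
next
  assume "int p dvd j"
  then obtain m where m: "j = int p * m" by blast
  have "s [^] j = (s [^] int p) [^] m" unfolding m using assms(1) by (simp add: int_pow_pow)
  then show "s [^] j = \<one>" using assms(3) by simp
qed

text \<open>
  Starting from an element of order \<open>p\<close>, a \<open>p\<close>-th root multiplies the
  order by exactly \<open>p\<close>.
\<close>
lemma (in group) pruefer_chain_exists:
  assumes chain: "torsion_chain G" and p: "prime (p::nat)"
    and s: "s \<in> carrier G" "s \<noteq> \<one>" "s [^] int p = \<one>"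
  shows "\<exists>t. \<forall>k. (t k \<in> torsion G \<and> (\<forall>j::int. t k [^] j = \<one> \<longleftrightarrow> int p ^ Suc k dvd j)) \<and>
             t (Suc k) [^] int p = t k"
proof (rule dependent_nat_choice)
  have "s \<in> torsion G" using torsionI[OF s(1,3)] prime_gt_0_nat[OF p] by simp
  then show "\<exists>x. x \<in> torsion G \<and> (\<forall>j::int. x [^] j = \<one> \<longleftrightarrow> int p ^ Suc 0 dvd j)"
    using int_pow_prime_eq_one_iff[OF s p] by auto
next
  fix x k
  assume x: "x \<in> torsion G \<and> (\<forall>j::int. x [^] j = \<one> \<longleftrightarrow> int p ^ Suc k dvd j)"
  have "int p > 0" using prime_gt_0_nat[OF p] by simp
  then obtain z where z: "z \<in> torsion G" "z [^] int p = x"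
    using torsion_chain_divisible[OF chain] x unfolding divisible_set_def by blast
  have zc: "z \<in> carrier G" using z(1) torsion_carrier by blast
  have zx: "z [^] (int p * m) = x [^] m" for m :: int
    using zc z(2) by (simp flip: int_pow_pow)
  have "z [^] j = \<one> \<longleftrightarrow> int p ^ Suc (Suc k) dvd j" for j :: int
  proof
    assume j: "z [^] j = \<one>"
    have "x [^] j = (z [^] j) [^] int p" using zc by (simp add: int_pow_pow mult.commute flip: zx)
    then have "x [^] j = \<one>" using j by simp
    then have "int p ^ Suc k dvd j" using x by blast
    then have "int p dvd j" using dvd_trans[of "int p" "int p ^ Suc k" j] by simp
    then obtain m where m: "j = int p * m" by blast
    have "x [^] m = \<one>" using j zx m by simp
    then have "int p ^ Suc k dvd m" using x by blast
    then show "int p ^ Suc (Suc k) dvd j" using m by (simp add: mult_dvd_mono)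
  next
    assume "int p ^ Suc (Suc k) dvd j"
    then obtain m where "j = int p ^ Suc (Suc k) * m" by (rule dvdE)
    then have m: "j = int p * (int p ^ Suc k * m)" by simp
    have "x [^] (int p ^ Suc k * m) = \<one>" using x by (meson dvd_triv_left)
    then show "z [^] j = \<one>" using zx m by simp
  qed
  then show "\<exists>z. (z \<in> torsion G \<and> (\<forall>j::int. z [^] j = \<one> \<longleftrightarrow> int p ^ Suc (Suc k) dvd j)) \<and> z [^] int p = x"
    using z by blast
qed

text \<open>
  Elements of infinite order split into a power of some \<open>a k\<close> and a torsion element; a
  torsion element with exponent \<open>p\<^sup>m\<close> is a power of \<open>t m\<close>, because
  \<open>t m\<close> has larger order.
\<close>
lemma rational_times_pruefer_resolution:
  assumes K: "rational_times_pruefer p K"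
  shows "\<exists>a t. resolution p K a t"
proof -
  interpret comm_group K using K by (simp add: rational_times_pruefer_def)
  have div: "divisible_set K (carrier K)" and chain: "torsion_chain K" and p: "prime p"
    and comm: "\<And>x y. x \<in> nontorsion K \<Longrightarrow> y \<in> nontorsion K \<Longrightarrow> commensurable K x y"
    using K by (auto simp: rational_times_pruefer_def)
  obtain s where s: "s \<in> carrier K" "s \<noteq> \<one>\<^bsub>K\<^esub>" "s [^]\<^bsub>K\<^esub> int p = \<one>\<^bsub>K\<^esub>"
    using K by (auto simp: rational_times_pruefer_def)
  obtain x where x: "x \<in> nontorsion K" using K by (auto simp: rational_times_pruefer_def)
  obtain a :: "nat \<Rightarrow> 'a" where a: "\<forall>k. a k \<in> nontorsion K" "\<forall>k. a (Suc k) [^]\<^bsub>K\<^esub> int (Suc k) = a k"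
    "rational_spine K {y. \<exists>k. has_power K (a k) y}"
    by (rule rational_spine_exists[OF div x])
  obtain t where t: "\<And>k. t k \<in> torsion K" "\<And>k. t (Suc k) [^]\<^bsub>K\<^esub> int p = t k"
    "\<And>k (j::int). t k [^]\<^bsub>K\<^esub> j = \<one>\<^bsub>K\<^esub> \<longleftrightarrow> int p ^ Suc k dvd j"
    using pruefer_chain_exists[OF chain p s] by blast
  have ac: "a k \<in> carrier K" for k using a(1) nontorsion_carrier by blast
  have tc: "t k \<in> carrier K" for k using t(1) torsion_carrier by blast
  have a_up: "\<exists>m::int. a k = a l [^]\<^bsub>K\<^esub> m" if "k \<le> l" for k l
    using root_chain_eq_pow[of a "\<lambda>k. int (Suc k)", OF ac _ that] a(2) by blast
  have t_up: "\<exists>m::int. t k = t l [^]\<^bsub>K\<^esub> m" if "k \<le> l" for k l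
    using root_chain_eq_pow[of t "\<lambda>k. int p", OF tc t(2) that] by blast
  have torsion_pow_t: "\<exists>k (j::int). y = t k [^]\<^bsub>K\<^esub> j" if y: "y \<in> torsion K" for y
  proof -
    have yc: "y \<in> carrier K" using y torsion_carrier by blast
    obtain m where m: "y [^]\<^bsub>K\<^esub> (int p ^ m) = \<one>\<^bsub>K\<^esub>" using torsion_chain_primary[OF chain p s y] by blast
    have "\<not> has_power K y (t m)"
    proof
      assume "has_power K y (t m)"
      then obtain j :: int where "t m = y [^]\<^bsub>K\<^esub> j" by (auto simp: has_power_def)
      then have "t m [^]\<^bsub>K\<^esub> (int p ^ m) = (y [^]\<^bsub>K\<^esub> (int p ^ m)) [^]\<^bsub>K\<^esub> j"
        using yc by (simp add: int_pow_pow mult.commute)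
      then have "int p ^ Suc m dvd int p ^ m" using m t(3) by simp
      then have "p ^ Suc m dvd p ^ m" by (simp only: of_nat_dvd_iff flip: of_nat_power)
      then show False using prime_gt_1_nat[OF p] power_dvd_imp_le[of p "Suc m" m] by simp
    qed
    then have "has_power K (t m) y" using chain t(1) y unfolding torsion_chain_def comparable_def by blast
    then show ?thesis by (auto simp: has_power_def)
  qed
  have central: "d \<otimes>\<^bsub>K\<^esub> z = z \<otimes>\<^bsub>K\<^esub> d"
    if "d \<in> {y. \<exists>k. has_power K (a k) y}" "z \<in> carrier K" for d z
  proof -
    have "d \<in> carrier K" using that(1) has_power_carrier[OF ac] by auto
    then show ?thesis using that(2) by (rule m_comm)
  qed
  have exhaust: "\<exists>k (i::int) (j::int). y = a k [^]\<^bsub>K\<^esub> i \<otimes>\<^bsub>K\<^esub> t k [^]\<^bsub>K\<^esub> j" if y: "y \<in> carrier K" for y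
  proof -
    have "\<exists>d u. (\<exists>k (i::int). d = a k [^]\<^bsub>K\<^esub> i) \<and> u \<in> torsion K \<and> y = d \<otimes>\<^bsub>K\<^esub> u"
    proof (cases "y \<in> torsion K")
      case True
      then show ?thesis
        using y by (intro exI[of _ "\<one>\<^bsub>K\<^esub>"] exI[of _ y]) (auto intro!: exI[of _ 0] exI[of _ "0::int"])
    next
      case False
      then have "y \<in> nontorsion K" using y by (simp add: nontorsion_def)
      then obtain d u where du: "d \<in> {y. \<exists>k. has_power K (a k) y}" "u \<in> torsion K" "y = d \<otimes>\<^bsub>K\<^esub> u"
        using rational_spine_splits[OF a(3) central comm] by blast
      then show ?thesis unfolding has_power_def by blast
    qed
    then obtain k u and i :: int where u: "u \<in> torsion K" "y = a k [^]\<^bsub>K\<^esub> i \<otimes>\<^bsub>K\<^esub> u" by blast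
    obtain l and j :: int where l: "u = t l [^]\<^bsub>K\<^esub> j" using torsion_pow_t[OF u(1)] by blast
    obtain m :: int where m: "a k = a (max k l) [^]\<^bsub>K\<^esub> m" using a_up[of k "max k l"] by auto
    obtain n :: int where n: "t l = t (max k l) [^]\<^bsub>K\<^esub> n" using t_up[of l "max k l"] by auto
    have "y = a (max k l) [^]\<^bsub>K\<^esub> (m * i) \<otimes>\<^bsub>K\<^esub> t (max k l) [^]\<^bsub>K\<^esub> (n * j)"
      using u(2) l m n ac tc by (metis int_pow_pow)
    then show ?thesis by blast
  qed
  have "resolution p K a t"
    unfolding resolution_def
    by (intro conjI allI ballI;
        (rule a(1)[rule_format] a(2)[rule_format] tc t(2) t(3) | erule exhaust))
  then show ?thesis by blast
qed

lemma resolution_eq_one_iff: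
  assumes "group K" "prime p" and K: "resolution p K a t"
  shows "a k [^]\<^bsub>K\<^esub> (i::int) \<otimes>\<^bsub>K\<^esub> t k [^]\<^bsub>K\<^esub> (j::int) = \<one>\<^bsub>K\<^esub> \<longleftrightarrow> i = 0 \<and> int p ^ Suc k dvd j"
proof -
  interpret group K by fact
  have a: "a k \<in> nontorsion K" and t: "t k \<in> carrier K"
    and t1: "\<And>j::int. t k [^]\<^bsub>K\<^esub> j = \<one>\<^bsub>K\<^esub> \<longleftrightarrow> int p ^ Suc k dvd j"
    using K unfolding resolution_def by blast+
  have ac: "a k \<in> carrier K" using a nontorsion_carrier by blast
  have "t k \<in> torsion K"
    using torsionI[OF t, of "int p ^ Suc k"] t1 prime_gt_0_nat[OF \<open>prime p\<close>] by simp
  have "i = 0" if one: "a k [^]\<^bsub>K\<^esub> i \<otimes>\<^bsub>K\<^esub> t k [^]\<^bsub>K\<^esub> j = \<one>\<^bsub>K\<^esub>"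
  proof (rule ccontr)
    assume "i \<noteq> 0"
    have "a k [^]\<^bsub>K\<^esub> i = t k [^]\<^bsub>K\<^esub> (- j)"
      using inv_equality[OF one] ac t by (simp add: int_pow_neg)
    then have "a k [^]\<^bsub>K\<^esub> i \<in> torsion K" using torsion_pow[OF \<open>t k \<in> torsion K\<close>] by simp
    then show False using nontorsion_pow[OF a \<open>i \<noteq> 0\<close>] by (simp add: nontorsion_def)
  qed
  moreover have "a k [^]\<^bsub>K\<^esub> i \<otimes>\<^bsub>K\<^esub> t k [^]\<^bsub>K\<^esub> j = t k [^]\<^bsub>K\<^esub> j" if "i = 0"
    using that t by simp
  ultimately show ?thesis using t1[of j] by metis
qed

text \<open>
  The map sending \<open>(a k)\<^sup>i (t k)\<^sup>j\<close> to
  \<open>(b k)\<^sup>i (u k)\<^sup>j\<close> is well defined and injective: expressions with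
  different \<open>k\<close> are brought to a common \<open>k\<close> by the same exponents in both
  groups, and for fixed \<open>k\<close> both groups have the same relations.
\<close>
lemma resolutions_imp_iso:
  assumes p: "prime p" and "comm_group K" "comm_group L" and K: "resolution p K a t" and L: "resolution p L b u"
  shows "K \<cong> L"
proof -
  interpret K: comm_group K by fact
  interpret L: comm_group L by fact
  have a: "\<And>k. a k \<in> nontorsion K" "\<And>k. a (Suc k) [^]\<^bsub>K\<^esub> int (Suc k) = a k"
    and t: "\<And>k. t k \<in> carrier K" "\<And>k. t (Suc k) [^]\<^bsub>K\<^esub> int p = t k"
    and t1: "\<And>k (j::int). t k [^]\<^bsub>K\<^esub> j = \<one>\<^bsub>K\<^esub> \<longleftrightarrow> int p ^ Suc k dvd j"
    and exK: "\<And>y. y \<in> carrier K \<Longrightarrow> \<exists>k (i::int) (j::int). y = a k [^]\<^bsub>K\<^esub> i \<otimes>\<^bsub>K\<^esub> t k [^]\<^bsub>K\<^esub> j"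
    using K unfolding resolution_def by blast+
  have b: "\<And>k. b k \<in> nontorsion L" "\<And>k. b (Suc k) [^]\<^bsub>L\<^esub> int (Suc k) = b k"
    and u: "\<And>k. u k \<in> carrier L" "\<And>k. u (Suc k) [^]\<^bsub>L\<^esub> int p = u k"
    and u1: "\<And>k (j::int). u k [^]\<^bsub>L\<^esub> j = \<one>\<^bsub>L\<^esub> \<longleftrightarrow> int p ^ Suc k dvd j"
    and exL: "\<And>y. y \<in> carrier L \<Longrightarrow> \<exists>k (i::int) (j::int). y = b k [^]\<^bsub>L\<^esub> i \<otimes>\<^bsub>L\<^esub> u k [^]\<^bsub>L\<^esub> j"
    using L unfolding resolution_def by blast+
  have ac: "a k \<in> carrier K" and bc: "b k \<in> carrier L" for k
    using a(1) b(1) K.nontorsion_carrier L.nontorsion_carrier by blast+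
  define ek where "ek k i j = a k [^]\<^bsub>K\<^esub> i \<otimes>\<^bsub>K\<^esub> t k [^]\<^bsub>K\<^esub> j" for k and i j :: int
  define el where "el k i j = b k [^]\<^bsub>L\<^esub> i \<otimes>\<^bsub>L\<^esub> u k [^]\<^bsub>L\<^esub> j" for k and i j :: int
  have ek_closed: "ek k i j \<in> carrier K" and el_closed: "el k i j \<in> carrier L" for k i j
    using ac bc t(1) u(1) by (simp_all add: ek_def el_def)
  have ek_mult: "ek k i j \<otimes>\<^bsub>K\<^esub> ek k i' j' = ek k (i + i') (j + j')" for k i j i' j'
    using ac t(1) by (simp add: ek_def K.int_pow_mult K.m_ac)
  have el_mult: "el k i j \<otimes>\<^bsub>L\<^esub> el k i' j' = el k (i + i') (j + j')" for k i j i' j'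
    using bc u(1) by (simp add: el_def L.int_pow_mult L.m_ac)
  have ek_one: "ek k i j = \<one>\<^bsub>K\<^esub> \<longleftrightarrow> i = 0 \<and> int p ^ Suc k dvd j" for k i j
    using resolution_eq_one_iff[OF K.is_group p K] by (simp add: ek_def)
  have el_one: "el k i j = \<one>\<^bsub>L\<^esub> \<longleftrightarrow> i = 0 \<and> int p ^ Suc k dvd j" for k i j
    using resolution_eq_one_iff[OF L.is_group p L] by (simp add: el_def)
  have ek_eq: "ek k i j = ek k i' j' \<longleftrightarrow> ek k (i - i') (j - j') = \<one>\<^bsub>K\<^esub>" for k i j i' j'
    using K.r_cancel_one[OF ek_closed[of k i' j'] ek_closed[of k "i - i'" "j - j'"]]
    by (simp add: ek_mult)
  have el_eq: "el k i j = el k i' j' \<longleftrightarrow> el k (i - i') (j - j') = \<one>\<^bsub>L\<^esub>" for k i j i' j'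
    using L.r_cancel_one[OF el_closed[of k i' j'] el_closed[of k "i - i'" "j - j'"]]
    by (simp add: el_mult)
  have lift: "\<exists>m n. \<forall>i j. ek k i j = ek l (m * i) (n * j) \<and> el k i j = el l (m * i) (n * j)" if "k \<le> l" for k l
  proof (intro exI allI conjI)
    let ?m = "\<Prod>i=k..<l. int (Suc i)" and ?n = "\<Prod>i=k..<l. int p"
    fix i j
    have "a k = a l [^]\<^bsub>K\<^esub> ?m" by (rule K.root_chain_eq_pow[where s = a and e = "\<lambda>i. int (Suc i)", OF ac a(2) that])
    moreover have "t k = t l [^]\<^bsub>K\<^esub> ?n" by (rule K.root_chain_eq_pow[where s = t and e = "\<lambda>i. int p", OF t that])
    ultimately show "ek k i j = ek l (?m * i) (?n * j)"
      unfolding ek_def using K.int_pow_pow[OF ac] K.int_pow_pow[OF t(1)] by simp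
    have "b k = b l [^]\<^bsub>L\<^esub> ?m" by (rule L.root_chain_eq_pow[where s = b and e = "\<lambda>i. int (Suc i)", OF bc b(2) that])
    moreover have "u k = u l [^]\<^bsub>L\<^esub> ?n" by (rule L.root_chain_eq_pow[where s = u and e = "\<lambda>i. int p", OF u that])
    ultimately show "el k i j = el l (?m * i) (?n * j)"
      unfolding el_def using L.int_pow_pow[OF bc] L.int_pow_pow[OF u(1)] by simp
  qed
  have common: "\<exists>l i1 j1 i2 j2. ek k i j = ek l i1 j1 \<and> el k i j = el l i1 j1 \<and>
      ek k' i' j' = ek l i2 j2 \<and> el k' i' j' = el l i2 j2" for k i j k' i' j'
    using lift[OF max.cobounded1, of k k'] lift[OF max.cobounded2, of k' k] by blast
  have same: "ek k i j = ek k' i' j' \<longleftrightarrow> el k i j = el k' i' j'" for k i j k' i' j'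
  proof -
    obtain l i1 j1 i2 j2 where eqs: "ek k i j = ek l i1 j1" "el k i j = el l i1 j1"
      "ek k' i' j' = ek l i2 j2" "el k' i' j' = el l i2 j2"
      using common[of k i j k' i' j'] by blast
    show ?thesis unfolding eqs ek_eq el_eq ek_one el_one by (rule refl)
  qed
  define \<phi> where "\<phi> y = (SOME z. \<exists>k i j. y = ek k i j \<and> z = el k i j)" for y
  have \<phi>: "\<phi> (ek k i j) = el k i j" for k i j
    unfolding \<phi>_def
  proof (rule some_equality)
    show "\<exists>k' i' j'. ek k i j = ek k' i' j' \<and> el k i j = el k' i' j'" by blast
    fix z assume "\<exists>k' i' j'. ek k i j = ek k' i' j' \<and> z = el k' i' j'"
    then obtain k' i' j' where "ek k i j = ek k' i' j'" "z = el k' i' j'" by blast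
    then show "z = el k i j" using same[of k i j k' i' j'] by simp
  qed
  have exK': "\<exists>k i j. y = ek k i j" if "y \<in> carrier K" for y using exK[OF that] by (simp add: ek_def)
  have exL': "\<exists>k i j. y = el k i j" if "y \<in> carrier L" for y using exL[OF that] by (simp add: el_def)
  have "\<phi> \<in> hom K L"
  proof (rule homI)
    fix x y assume x: "x \<in> carrier K" and y: "y \<in> carrier K"
    show "\<phi> x \<in> carrier L" using exK'[OF x] \<phi> el_closed by metis
    obtain k i j k' i' j' where "x = ek k i j" "y = ek k' i' j'"
      using exK'[OF x] exK'[OF y] by blast
    then obtain l i1 j1 i2 j2 where "x = ek l i1 j1" "y = ek l i2 j2"
      using common[of k i j k' i' j'] by blast
    then show "\<phi> (x \<otimes>\<^bsub>K\<^esub> y) = \<phi> x \<otimes>\<^bsub>L\<^esub> \<phi> y" by (simp add: \<phi> ek_mult el_mult)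
  qed
  moreover have "bij_betw \<phi> (carrier K) (carrier L)"
  proof (rule bij_betw_imageI)
    show "inj_on \<phi> (carrier K)"
    proof (rule inj_onI)
      fix x y assume "x \<in> carrier K" "y \<in> carrier K" "\<phi> x = \<phi> y"
      then show "x = y" using exK' \<phi> same by metis
    qed
    show "\<phi> ` carrier K = carrier L"
    proof (intro equalityI subsetI)
      fix z assume "z \<in> \<phi> ` carrier K"
      then show "z \<in> carrier L" using exK' \<phi> el_closed by (metis imageE)
    next
      fix z assume "z \<in> carrier L"
      then show "z \<in> \<phi> ` carrier K" using exL' \<phi> ek_closed by (metis imageI)
    qed
  qed
  ultimately show ?thesis unfolding is_iso_def iso_def by blast
qed

section \<open>The direct product of the rationals and a Pruefer group\<close>

lemma rational_pruefer_ops: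
  "\<one>\<^bsub>rational_group\<^esub> = 0" "x \<otimes>\<^bsub>rational_group\<^esub> y = x + y"
  "\<one>\<^bsub>pruefer_group p\<^esub> = 1" "z \<otimes>\<^bsub>pruefer_group p\<^esub> w = z * w"
  by (simp_all add: rational_group_def pruefer_group_def)

lemma carrier_rational_pruefer:
  "carrier (rational_group \<times>\<times> pruefer_group p) = {x. \<exists>k. snd x ^ (p ^ k) = 1}"
  by (auto simp: rational_group_def pruefer_group_def)

lemma comm_group_rational_pruefer:
  assumes "prime p"
  shows "comm_group (rational_group \<times>\<times> pruefer_group p)"
proof (rule group.group_comm_groupI)
  show "group (rational_group \<times>\<times> pruefer_group p)"
    by (rule DirProd_group[OF group_rational_group group_pruefer_group[OF assms]])
qed (auto simp: rational_pruefer_ops mult_DirProd')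

lemma rational_pruefer_nat_pow:
  "x [^]\<^bsub>rational_group \<times>\<times> pruefer_group p\<^esub> (n::nat) = (of_nat n * fst x, snd x ^ n)"
  by (induction n) (auto simp: rational_pruefer_ops mult_DirProd' algebra_simps)

lemma fst_rational_pruefer_int_pow:
  assumes "prime p" "x \<in> carrier (rational_group \<times>\<times> pruefer_group p)"
  shows "fst (x [^]\<^bsub>rational_group \<times>\<times> pruefer_group p\<^esub> (n::int)) = of_int n * fst x"
proof -
  interpret H: comm_group "rational_group \<times>\<times> pruefer_group p" using comm_group_rational_pruefer assms(1) .
  show ?thesis
  proof (cases n rule: int_cases2)
    case (nonneg m)
    then show ?thesis by (simp add: int_pow_int rational_pruefer_nat_pow)
  next
    case (nonpos m)
    have "x [^]\<^bsub>rational_group \<times>\<times> pruefer_group p\<^esub> n \<otimes>\<^bsub>rational_group \<times>\<times> pruefer_group p\<^esub>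
        x [^]\<^bsub>rational_group \<times>\<times> pruefer_group p\<^esub> int m = \<one>\<^bsub>rational_group \<times>\<times> pruefer_group p\<^esub>"
      using nonpos H.int_pow_mult[OF assms(2), of n "int m", symmetric] by simp
    then have "fst (x [^]\<^bsub>rational_group \<times>\<times> pruefer_group p\<^esub> n \<otimes>\<^bsub>rational_group \<times>\<times> pruefer_group p\<^esub>
        x [^]\<^bsub>rational_group \<times>\<times> pruefer_group p\<^esub> int m) = 0"
      by (simp add: rational_pruefer_ops)
    then show ?thesis
      using nonpos by (simp add: int_pow_int rational_pruefer_nat_pow mult_DirProd' rational_pruefer_ops)
  qed
qed

lemma torsion_rational_pruefer:
  assumes p: "prime p"
  shows "torsion (rational_group \<times>\<times> pruefer_group p) = {x. fst x = 0 \<and> (\<exists>k. snd x ^ (p ^ k) = 1)}"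
    (is "torsion ?H = ?T")
proof (intro equalityI subsetI)
  interpret H: comm_group ?H using comm_group_rational_pruefer p .
  fix x assume x: "x \<in> torsion ?H"
  then have xc: "x \<in> carrier ?H" by (rule H.torsion_carrier)
  obtain n :: nat where "n > 0" "x [^]\<^bsub>?H\<^esub> n = \<one>\<^bsub>?H\<^esub>" using x by (rule H.torsion_nat_pow)
  then have "fst x = 0" by (simp add: rational_pruefer_nat_pow rational_pruefer_ops)
  then show "x \<in> ?T" using xc by (simp only: carrier_rational_pruefer mem_Collect_eq)
next
  interpret H: comm_group ?H using comm_group_rational_pruefer p .
  fix x assume x: "x \<in> ?T"
  then obtain k where k: "fst x = 0" "snd x ^ (p ^ k) = 1" by blast
  have "x [^]\<^bsub>?H\<^esub> int (p ^ k) = \<one>\<^bsub>?H\<^esub>"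
    unfolding int_pow_int rational_pruefer_nat_pow using k by (simp add: rational_pruefer_ops)
  moreover have "x \<in> carrier ?H" using k by (auto simp only: carrier_rational_pruefer)
  moreover have "int (p ^ k) \<noteq> 0" using prime_gt_0_nat[OF p] by simp
  ultimately show "x \<in> torsion ?H" using H.torsionI by blast
qed

text \<open>
  Orders are powers of \<open>p\<close>, hence comparable by divisibility. If the order of
  \<open>x\<close> divides the order \<open>n\<close> of \<open>y\<close>, then \<open>x\<close>
  lies among the torsion elements with exponent \<open>n\<close>; these inject into the
  \<open>n\<close> complex \<open>n\<close>-th roots of unity, so they are already exhausted by the
  \<open>n\<close> powers of \<open>y\<close>.
\<close>
lemma torsion_chain_rational_pruefer:
  assumes p: "prime p"
  shows "torsion_chain (rational_group \<times>\<times> pruefer_group p)" (is "torsion_chain ?H")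
  unfolding torsion_chain_def
proof (intro conjI ballI)
  interpret H: comm_group ?H using comm_group_rational_pruefer p .
  note T = torsion_rational_pruefer[OF p]
  have p1: "p > 1" using prime_gt_1_nat[OF p] .
  show "infinite (torsion ?H)"
  proof
    assume fin: "finite (torsion ?H)"
    define k where "k = card (torsion ?H)"
    have "Pair 0 ` {z::complex. z ^ (p ^ k) = 1} \<subseteq> torsion ?H" unfolding T by auto
    then have "card (Pair (0::rat) ` {z::complex. z ^ (p ^ k) = 1}) \<le> k"
      using card_mono[OF fin] by (simp add: k_def)
    moreover have "card (Pair (0::rat) ` {z::complex. z ^ (p ^ k) = 1}) = p ^ k"
      using p1 by (subst card_image) (auto simp: inj_on_def card_roots_unity_eq)
    ultimately show False using power_gt_expt[of p k] p1 by simp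
  qed
  have pow: "has_power ?H y x"
    if x: "x \<in> torsion ?H" and y: "y \<in> torsion ?H" and dvd: "H.ord x dvd H.ord y" for x y
  proof -
    have xc: "x \<in> carrier ?H" and yc: "y \<in> carrier ?H" using x y H.torsion_carrier by blast+
    define n where "n = H.ord y"
    obtain m :: nat where "m > 0" "y [^]\<^bsub>?H\<^esub> m = \<one>\<^bsub>?H\<^esub>" using y by (rule H.torsion_nat_pow)
    then have n: "n > 0" using H.pow_eq_id[OF yc] by (auto simp: n_def intro: Nat.gr0I)
    define U where "U = {z \<in> torsion ?H. z [^]\<^bsub>?H\<^esub> n = \<one>\<^bsub>?H\<^esub>}"
    have "snd ` U \<subseteq> {z. z ^ n = 1}"
      by (auto simp: U_def rational_pruefer_nat_pow rational_pruefer_ops)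
    moreover have "finite {z::complex. z ^ n = 1}" using n by (intro finite_roots_unity) simp
    moreover have "inj_on snd U" unfolding U_def T by (auto simp: inj_on_def)
    ultimately have U: "finite U" "card U \<le> n"
      using card_roots_unity_eq[of n] n card_inj_on_le[of snd U "{z. z ^ n = 1}"]
        inj_on_finite[of snd U "{z. z ^ n = 1}"] by simp_all
    have "(\<lambda>i. y [^]\<^bsub>?H\<^esub> i) ` {0..n - 1} \<subseteq> U"
    proof
      fix z assume "z \<in> (\<lambda>i. y [^]\<^bsub>?H\<^esub> i) ` {0..n - 1}"
      then obtain i :: nat where i: "z = y [^]\<^bsub>?H\<^esub> i" by blast
      have "z \<in> torsion ?H" using H.torsion_pow[OF y, of "int i"] i by (simp add: int_pow_int)
      moreover have "z [^]\<^bsub>?H\<^esub> n = \<one>\<^bsub>?H\<^esub>"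
      proof -
        have "z [^]\<^bsub>?H\<^esub> n = (y [^]\<^bsub>?H\<^esub> n) [^]\<^bsub>?H\<^esub> i"
          unfolding i by (simp only: H.nat_pow_pow[OF yc] mult.commute)
        then show ?thesis unfolding n_def by (simp only: H.pow_ord_eq_1[OF yc] H.nat_pow_one)
      qed
      ultimately show "z \<in> U" unfolding U_def by blast
    qed
    moreover have "card ((\<lambda>i. y [^]\<^bsub>?H\<^esub> i) ` {0..n - 1}) = n"
      using card_image[OF H.ord_inj[OF yc]] n by (simp add: n_def)
    ultimately have img: "(\<lambda>i. y [^]\<^bsub>?H\<^esub> i) ` {0..n - 1} = U"
      using U by (metis card_seteq)
    have "x [^]\<^bsub>?H\<^esub> n = \<one>\<^bsub>?H\<^esub>" using dvd H.pow_eq_id[OF xc] unfolding n_def by blast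
    then have "x \<in> U" using x unfolding U_def by blast
    then obtain i :: nat where i: "x = y [^]\<^bsub>?H\<^esub> i" using img by blast
    \<comment> \<open>Adding \<open>n\<close> to the exponent makes it nonzero without changing the power.\<close>
    have "y [^]\<^bsub>?H\<^esub> int (i + n) = y [^]\<^bsub>?H\<^esub> i \<otimes>\<^bsub>?H\<^esub> y [^]\<^bsub>?H\<^esub> n"
      by (simp only: int_pow_int H.nat_pow_mult[OF yc])
    also have "\<dots> = x"
      unfolding n_def by (simp only: H.pow_ord_eq_1[OF yc] H.r_one[OF xc] flip: i)
    finally have "x = y [^]\<^bsub>?H\<^esub> int (i + n)" by (rule sym)
    then show ?thesis using n unfolding has_power_def by (intro exI[of _ "int (i + n)"]) simp
  qed
  have ord_pow: "\<exists>i. H.ord x = p ^ i" if x: "x \<in> torsion ?H" for x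
  proof -
    obtain k where k: "fst x = 0" "snd x ^ (p ^ k) = 1" using x unfolding T by blast
    then have "x [^]\<^bsub>?H\<^esub> (p ^ k) = \<one>\<^bsub>?H\<^esub>"
      unfolding rational_pruefer_nat_pow by (simp add: rational_pruefer_ops)
    then have "H.ord x dvd p ^ k" using H.pow_eq_id[OF H.torsion_carrier[OF x]] by blast
    then show ?thesis using divides_primepow_nat[OF p] by blast
  qed
  fix x y assume x: "x \<in> torsion ?H" and y: "y \<in> torsion ?H"
  obtain i j where ij: "H.ord x = p ^ i" "H.ord y = p ^ j" using ord_pow x y by blast
  have "H.ord x dvd H.ord y \<or> H.ord y dvd H.ord x"
    using linear[of i j] by (auto simp: ij le_imp_power_dvd)
  then show "comparable ?H x y" using pow[OF x y] pow[OF y x] unfolding comparable_def by blast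
qed

lemma rational_pruefer_is_rational_times_pruefer:
  assumes p: "prime p"
  shows "rational_times_pruefer p (rational_group \<times>\<times> pruefer_group p)"
    (is "rational_times_pruefer p ?H")
proof -
  interpret H: comm_group ?H using comm_group_rational_pruefer p .
  note T = torsion_rational_pruefer[OF p]
  note C = carrier_rational_pruefer[of p]
  have chain: "torsion_chain ?H" using torsion_chain_rational_pruefer p .
  have "divisible_set ?H (carrier ?H)"
    unfolding divisible_set_def
  proof (intro ballI allI impI)
    fix x and n :: int assume x: "x \<in> carrier ?H" and n: "n > 0"
    have "(0, snd x) \<in> torsion ?H" using x unfolding C T by simp
    then obtain w where w: "w \<in> torsion ?H" "w [^]\<^bsub>?H\<^esub> n = (0, snd x)"
      using H.torsion_chain_divisible[OF chain] n unfolding divisible_set_def by blast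
    define v where "v = (fst x / of_int n, 1::complex)"
    have v: "v \<in> carrier ?H" unfolding C v_def by simp
    have "v [^]\<^bsub>?H\<^esub> int (nat n) = (fst x, 1)"
      unfolding int_pow_int rational_pruefer_nat_pow using n by (simp add: v_def)
    then have "(v \<otimes>\<^bsub>?H\<^esub> w) [^]\<^bsub>?H\<^esub> n = (fst x, 1) \<otimes>\<^bsub>?H\<^esub> (0, snd x)"
      using v w n H.torsion_carrier by (simp add: H.int_pow_distrib)
    also have "\<dots> = x" by (simp add: mult_DirProd' rational_pruefer_ops)
    finally show "\<exists>y\<in>carrier ?H. y [^]\<^bsub>?H\<^esub> n = x" using v w(1) H.torsion_carrier by blast
  qed
  moreover have "(1, 1) \<in> nontorsion ?H" unfolding nontorsion_def C T by simp
  moreover have "commensurable ?H x y" if x: "x \<in> nontorsion ?H" and y: "y \<in> nontorsion ?H" for x y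
  proof -
    have xc: "x \<in> carrier ?H" and yc: "y \<in> carrier ?H" using x y H.nontorsion_carrier by blast+
    have nz: "fst x \<noteq> 0" "fst y \<noteq> 0" using x y unfolding nontorsion_def C T by auto
    obtain m n :: int where mn: "n > 0" "fst x / fst y = of_int m / of_int n"
      using Rat_cases[of "fst x / fst y"] Fract_of_int_quotient by metis
    then have m: "m \<noteq> 0" using nz by auto
    define z where "z = x [^]\<^bsub>?H\<^esub> n \<otimes>\<^bsub>?H\<^esub> y [^]\<^bsub>?H\<^esub> (- m)"
    have "fst z = of_int n * fst x - of_int m * fst y"
      using fst_rational_pruefer_int_pow[OF p xc, of n] fst_rational_pruefer_int_pow[OF p yc, of "- m"]
      by (simp add: z_def mult_DirProd' rational_pruefer_ops)
    then have "fst z = 0" using mn nz by (simp add: field_simps)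
    moreover have zc: "z \<in> carrier ?H" using xc yc unfolding z_def by (intro H.m_closed H.int_pow_closed)
    ultimately have "z \<in> torsion ?H" unfolding C T by simp
    then obtain k :: int where k: "k \<noteq> 0" "z [^]\<^bsub>?H\<^esub> k = \<one>\<^bsub>?H\<^esub>" unfolding torsion_def by blast
    have "x [^]\<^bsub>?H\<^esub> n = z \<otimes>\<^bsub>?H\<^esub> y [^]\<^bsub>?H\<^esub> m"
      using xc yc by (simp only: z_def H.int_pow_neg H.m_assoc H.int_pow_closed H.inv_closed H.l_inv H.r_one)
    then have "(x [^]\<^bsub>?H\<^esub> n) [^]\<^bsub>?H\<^esub> k = z [^]\<^bsub>?H\<^esub> k \<otimes>\<^bsub>?H\<^esub> (y [^]\<^bsub>?H\<^esub> m) [^]\<^bsub>?H\<^esub> k"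
      using zc yc by (simp only: H.int_pow_distrib H.int_pow_closed)
    then have "x [^]\<^bsub>?H\<^esub> (n * k) = y [^]\<^bsub>?H\<^esub> (m * k)"
      using xc yc k(2) by (simp only: H.int_pow_pow H.l_one H.int_pow_closed)
    then show ?thesis
      using mn(1) m k(1) unfolding commensurable_def by (intro exI[of _ "n * k"] exI[of _ "m * k"]) simp
  qed
  moreover have "\<exists>s\<in>carrier ?H. s \<noteq> \<one>\<^bsub>?H\<^esub> \<and> s [^]\<^bsub>?H\<^esub> int p = \<one>\<^bsub>?H\<^esub>"
  proof -
    have "\<not> {z::complex. z ^ p = 1} \<subseteq> {1}"
    proof
      assume "{z::complex. z ^ p = 1} \<subseteq> {1}"
      then have "card {z::complex. z ^ p = 1} \<le> 1" using card_mono[of "{1::complex}"] by simp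
      then show False using card_roots_unity_eq[of p] prime_gt_1_nat[OF p] by simp
    qed
    then obtain z :: complex where z: "z ^ p = 1" "z \<noteq> 1" by blast
    then have "(0, z) \<in> carrier ?H" unfolding C by (auto intro: exI[of _ 1])
    moreover have "(0, z) [^]\<^bsub>?H\<^esub> int p = \<one>\<^bsub>?H\<^esub>"
      unfolding int_pow_int rational_pruefer_nat_pow using z by (simp add: rational_pruefer_ops)
    ultimately show ?thesis using z(2) by (intro bexI[of _ "(0, z)"]) (simp_all add: rational_pruefer_ops)
  qed
  ultimately show ?thesis
    using H.comm_group_axioms chain p unfolding rational_times_pruefer_def by blast
qed

theorem theorem4p4:
  fixes p :: nat and G :: "('a, 'm) monoid_scheme"
  assumes "prime p"
    and "group G"
    and "graph_isomorphic (power_graph (rational_group \<times>\<times> pruefer_group p)) (power_graph G)"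
  shows "G \<cong> rational_group \<times>\<times> pruefer_group p"
proof -
  have H: "rational_times_pruefer p (rational_group \<times>\<times> pruefer_group p)"
    using rational_pruefer_is_rational_times_pruefer assms(1) .
  have G: "rational_times_pruefer p G"
    using power_graph_iso_preserves_structure[OF H assms(2,3)] .
  obtain a t where "resolution p G a t" using rational_times_pruefer_resolution[OF G] by blast
  moreover obtain b u where "resolution p (rational_group \<times>\<times> pruefer_group p) b u"
    using rational_times_pruefer_resolution[OF H] by blast
  ultimately show ?thesis
    using resolutions_imp_iso assms(1) G H unfolding rational_times_pruefer_def by blast
qed

end
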